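(* Let $l_0,l_1,l_2,l_3$ be complex numbers, and for each $i\in\{0,1,2,3\}$ let $\alpha_i$ be a number such that $\alpha_i=-l_i$ or $\alpha_i=l_i+1$. Set $d=-\sum_{i=0}^3\alpha_i/2$ and assume $d\in\mathbf{Z}_{\geq 0}$. Let $V_{\alpha_0,\alpha_1,\alpha_2,\alpha_3}$ be the $(d+1)$-dimensional space of functions of $x$ spanned by $$\left\{\widehat{\Phi}(\wp(x))\,\wp(x)^n\right\}_{n=0,\dots,d},\qquad \widehat{\Phi}(z)=(z-e_1)^{\alpha_1/2}(z-e_2)^{\alpha_2/2}(z-e_3)^{\alpha_3/2},$$ and let $L_{\alpha_0,\alpha_1,\alpha_2,\alpha_3}$ be the monic linear ordinary differential operator in $x$ of order $d+1$ which annihilates every element of $V_{\alpha_0,\alpha_1,\alpha_2,\alpha_3}$. Then, as differential operators, $$\wp'(x)^{d+1}\prod_{i=1}^3(\wp(x)-e_i)^{\alpha_i/2}\circ\left(\frac{1}{\wp'(x)}\frac{d}{dx}\right)^{d+1}\circ\prod_{i=1}^3(\wp(x)-e_i)^{-\alpha_i/2}=L_{\alpha_0,\alpha_1,\alpha_2,\alpha_3}.$$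
   Context: $\wp(x)$ is the Weierstrass elliptic function with periods $2\omega_1,2\omega_3$ (linearly independent over the reals), $\omega_2=-\omega_1-\omega_3$, and $e_i=\wp(\omega_i)$ for $i=1,2,3$. "Monic of order $n$" means of the form $\left(\frac{d}{dx}\right)^{n}+\sum_{i=1}^{n}c_i(x)\left(\frac{d}{dx}\right)^{n-i}$. The symbol $\circ$ denotes composition of operators, functions acting by multiplication. The powers $(\wp(x)-e_i)^{\pm\alpha_i/2}$ are (generally multivalued) functions understood locally, away from the half-periods $\mathbf{Z}\omega_1+\mathbf{Z}\omega_3$, with a consistent choice of branch such that $(\wp(x)-e_i)^{\alpha_i/2}(\wp(x)-e_i)^{-\alpha_i/2}=1$; the same branch is used in $\widehat{\Phi}(\wp(x))$. *)

theory Defs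
  imports "HOL-Complex_Analysis.Complex_Analysis" "HOL-Library.Function_Algebras"
begin

definition period_lattice :: "complex \<Rightarrow> complex \<Rightarrow> complex set" where
  "period_lattice a b = {of_int m * a + of_int n * b | m n. True}"

text \<open>\<open>a\<close> and \<open>b\<close> are the full periods. The value at a lattice point (a pole) is junk.\<close>

definition weierstrass_p :: "complex \<Rightarrow> complex \<Rightarrow> complex \<Rightarrow> complex" where
  "weierstrass_p a b z =
     1 / z ^ 2 + (\<Sum>\<^sub>\<infinity>w \<in> period_lattice a b - {0}. 1 / (z - w) ^ 2 - 1 / w ^ 2)"

text \<open>\<open>p\<close> is a branch on \<open>U\<close> of the multivalued power \<open>g\<close> to the \<open>a\<close>: near each point of \<open>U\<close> it is
  \<open>exp (a * log g)\<close> for some holomorphic logarithm of \<open>g\<close>. Only local logarithms are required, so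
  that \<open>U\<close> need not be simply connected.\<close>

definition power_branch_on ::
    "complex set \<Rightarrow> (complex \<Rightarrow> complex) \<Rightarrow> complex \<Rightarrow> (complex \<Rightarrow> complex) \<Rightarrow> bool" where
  "power_branch_on U g a p \<longleftrightarrow>
     (\<forall>x\<in>U. \<exists>r>0. \<exists>h. ball x r \<subseteq> U \<and> h holomorphic_on ball x r \<and>
        (\<forall>y\<in>ball x r. exp (h y) = g y \<and> p y = exp (a * h y)))"

text \<open>The complex vector space structure on functions of a complex variable.\<close>

interpretation cfun: vector_space "\<lambda>(c::complex) (f::complex \<Rightarrow> complex) x. c * f x"
  by unfold_locales (auto simp: fun_eq_iff algebra_simps)

text \<open>The span of \<open>\<phi> q^n\<close>, \<open>n = 0,\<dots>,d\<close>, as functions on \<open>U\<close>. Functions on \<open>U\<close> are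
  represented by their extension by zero, so that linear (in)dependence is that on \<open>U\<close>.\<close>

definition power_span ::
    "complex set \<Rightarrow> (complex \<Rightarrow> complex) \<Rightarrow> (complex \<Rightarrow> complex) \<Rightarrow> nat \<Rightarrow> (complex \<Rightarrow> complex) set" where
  "power_span U \<phi> q d =
     cfun.span ((\<lambda>n x. if x \<in> U then \<phi> x * q x ^ n else 0) ` {0..d})"

text \<open>Differential operators on an open set \<open>U\<close> are represented by their action on total functions.
  Only the values at points of \<open>U\<close>, for functions holomorphic on \<open>U\<close>, are meaningful; hence the
  relation \<open>operators_eq_on\<close> in place of equality.\<close>

type_synonym foperator = "(complex \<Rightarrow> complex) \<Rightarrow> complex \<Rightarrow> complex"

definition mult_op :: "(complex \<Rightarrow> complex) \<Rightarrow> foperator" where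
  "mult_op g f = (\<lambda>x. g x * f x)"

definition operators_eq_on :: "complex set \<Rightarrow> foperator \<Rightarrow> foperator \<Rightarrow> bool" where
  "operators_eq_on U P Q \<longleftrightarrow> (\<forall>f. f holomorphic_on U \<longrightarrow> (\<forall>x\<in>U. P f x = Q f x))"

definition monic_diff_op_on :: "complex set \<Rightarrow> nat \<Rightarrow> foperator \<Rightarrow> bool" where
  "monic_diff_op_on U n L \<longleftrightarrow>
     (\<exists>c. (\<forall>i\<in>{1..n}. c i holomorphic_on U) \<and>
        operators_eq_on U L
          (\<lambda>f x. (deriv ^^ n) f x + (\<Sum>i = 1..n. c i x * (deriv ^^ (n - i)) f x)))"

definition monic_annihilator_on ::
    "complex set \<Rightarrow> nat \<Rightarrow> (complex \<Rightarrow> complex) set \<Rightarrow> foperator \<Rightarrow> bool" where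
  "monic_annihilator_on U n V L \<longleftrightarrow>
     monic_diff_op_on U n L \<and> (\<forall>v\<in>V. \<forall>x\<in>U. L v x = 0)"

end

theory Submission
  imports Defs
begin

text \<open>Put \<open>D = (1 / \<P>') d/dx\<close>, so that \<open>D\<close> acts on polynomials in \<open>\<P>\<close> as formal differentiation. Conjugating
  \<open>D^(d + 1)\<close> by \<open>\<Phi>\<close> therefore annihilates \<open>\<Phi> \<P>^n\<close> for \<open>n \<le> d\<close>, and the factor \<open>\<P>'^(d + 1)\<close> makes the result
  monic. A monic operator of order \<open>d + 1\<close> is determined by its kernel as soon as the kernel realises all jets
  of order \<open>d\<close> at each point, which the functions \<open>\<Phi> (\<P> - \<P> x)^k\<close> do. All of this needs \<open>\<P>'\<close> to have no zeros
  away from the half-periods; it is deduced from \<open>\<P>'' = 6 \<P>^2 + C\<close>, without counting zeros of elliptic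
  functions.\<close>

text \<open>The first order equation for \<open>(\<P>')^2\<close> would not do: at a zero of
  \<open>\<P>'\<close> a constant solves it as well, so uniqueness fails exactly where it is needed.
  Two solutions \<open>u\<close>, \<open>v\<close> of \<open>w'' = 6 w^2 + C\<close> satisfy
  \<open>(u - v)'' = 6 (u + v) (u - v)\<close>, which is linear in \<open>u - v\<close> and free of
  \<open>C\<close>. The nonvanishing of \<open>\<P>'\<close> then serves twice: it makes
  \<open>1 / \<P>'\<close> holomorphic on \<open>U\<close>, and it makes
  \<open>\<P> - \<P> x\<close> vanish to order exactly one at \<open>x\<close>. A second obstacle is
  the encoding: operators act on total functions but are constrained only on \<open>U\<close>.
  Elements of \<open>V\<close> are cut off to 0 outside \<open>U\<close>, the test functions are
  not, so locality of the operators has to be carried along.\<close>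

lemma summable_on_int_powr:
  assumes "s < -1"
  shows "(\<lambda>n::int. (1 + \<bar>of_int n\<bar> :: real) powr s) summable_on UNIV"
proof -
  have "summable (\<lambda>n. real n powr s)"
    using assms by (simp add: summable_real_powr_iff)
  then have "summable (\<lambda>n. real (Suc n) powr s)"
    by (subst summable_Suc_iff)
  then have nat: "(\<lambda>n. real (Suc n) powr s) summable_on UNIV"
    by (intro norm_summable_imp_summable_on) simp
  have "(\<lambda>n::int. (1 + \<bar>of_int n\<bar> :: real) powr s) summable_on range int"
    by (subst summable_on_reindex) (use nat in \<open>auto simp: o_def add_ac\<close>)
  moreover have "(\<lambda>n::int. (1 + \<bar>of_int n\<bar> :: real) powr s) summable_on range (\<lambda>n. - int n)"
    by (subst summable_on_reindex) (use nat in \<open>auto simp: o_def add_ac inj_on_def\<close>)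
  ultimately have "(\<lambda>n::int. (1 + \<bar>of_int n\<bar> :: real) powr s) summable_on (range int \<union> range (\<lambda>n. - int n))"
    by (rule summable_on_union)
  also have "range int \<union> range (\<lambda>n. - int n) = UNIV"
    by (auto simp: image_iff) (metis int_cases2)
  finally show ?thesis .
qed

section \<open>Period lattices\<close>

text \<open>Independence is over the reals. For \<open>a = b\<close> the set \<open>{a, b}\<close>
  collapses to a singleton, whose independence says nothing about two periods; hence the separate
  inequality.\<close>

locale complex_lattice =
  fixes a b :: complex
  assumes periods_neq: "a \<noteq> b" and periods_indep: "independent {a, b}"
begin

abbreviation "\<Lambda> \<equiv> period_lattice a b"

lemma lincomb_eq_0:
  assumes "of_real x * a + of_real y * b = 0"
  shows "x = 0 \<and> y = 0"
proof (rule ccontr)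
  assume *: "\<not> (x = 0 \<and> y = 0)"
  define u where "u = (\<lambda>v. if v = a then x else y)"
  have "(\<Sum>v\<in>{a, b}. u v *\<^sub>R v) = 0"
    using periods_neq assms by (simp add: u_def scaleR_conv_of_real)
  moreover have "u a \<noteq> 0 \<or> u b \<noteq> 0"
    using * periods_neq by (auto simp: u_def)
  ultimately have "dependent {a, b}"
    by (subst dependent_finite) blast+
  then show False
    using periods_indep by blast
qed

lemma lincomb_linear: "linear (\<lambda>(x, y). of_real x * a + of_real y * b)"
  by (rule linearI) (auto simp: scaleR_conv_of_real algebra_simps)

lemma lincomb_inj: "inj (\<lambda>(x, y). of_real x * a + of_real y * b)"
  unfolding linear_injective_0[OF lincomb_linear]
  by (auto simp: zero_prod_def dest!: lincomb_eq_0)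

text \<open>An injective linear map on a finite-dimensional space is bounded below. This bound
  yields both the convergence of the lattice sums and the discreteness of the lattice.\<close>

lemma lincomb_lower_bound:
  obtains c where "c > 0" "\<And>x y. norm (of_real x * a + of_real y * b) \<ge> c * sqrt (x\<^sup>2 + y\<^sup>2)"
proof -
  obtain B where "B > 0" and B: "\<And>p. B * norm p \<le> norm ((\<lambda>(x, y). of_real x * a + of_real y * b) p)"
    using linear_inj_bounded_below_pos[OF lincomb_linear lincomb_inj] by blast
  have "B * sqrt (x\<^sup>2 + y\<^sup>2) \<le> norm (of_real x * a + of_real y * b)" for x y
    using B[of "(x, y)"] by (simp add: norm_Pair)
  with \<open>B > 0\<close> show ?thesis
    by (rule that)
qed

lemma lincomb_surj: "\<exists>x y. z = of_real x * a + of_real y * b"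
proof -
  have "dim {a, b} = DIM(complex)"
    using dim_eq_card_independent[OF periods_indep] periods_neq by simp
  then have "z \<in> span {a, b}"
    using dim_eq_full[of "{a, b}"] by simp
  then obtain x y where "z - x *\<^sub>R a - y *\<^sub>R b = 0"
    by (auto simp: span_breakdown_eq)
  then have "z = of_real x * a + of_real y * b"
    by (simp add: scaleR_conv_of_real algebra_simps)
  then show ?thesis by blast
qed

lemma lattice_inj: "inj (\<lambda>(m, n). of_int m * a + of_int n * b)"
proof (rule injI, clarify)
  fix m n m' n' :: int
  assume "of_int m * a + of_int n * b = of_int m' * a + of_int n' * b"
  then have "of_real (of_int (m - m')) * a + of_real (of_int (n - n')) * b = 0"
    by (simp add: algebra_simps)
  from lincomb_eq_0[OF this] show "m = m' \<and> n = n'" by simp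
qed

lemma lattice_conv_range: "\<Lambda> = range (\<lambda>(m, n). of_int m * a + of_int n * b)"
  by (auto simp: period_lattice_def)

lemma lattice_0 [simp, intro]: "0 \<in> \<Lambda>"
  unfolding period_lattice_def by (rule CollectI, rule exI[of _ 0], rule exI[of _ 0]) simp

lemma lattice_add [intro]: "v \<in> \<Lambda> \<Longrightarrow> w \<in> \<Lambda> \<Longrightarrow> v + w \<in> \<Lambda>"
  unfolding period_lattice_def
  by (clarify, rule_tac x = "m + ma" in exI, rule_tac x = "n + na" in exI) (simp add: algebra_simps)

lemma lattice_uminus [intro]: "w \<in> \<Lambda> \<Longrightarrow> - w \<in> \<Lambda>"
  unfolding period_lattice_def
  by (clarify, rule_tac x = "- m" in exI, rule_tac x = "- n" in exI) (simp add: algebra_simps)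

lemma lattice_uminus_iff [simp]: "- w \<in> \<Lambda> \<longleftrightarrow> w \<in> \<Lambda>"
  using lattice_uminus by force

lemma lattice_diff [intro]: "v \<in> \<Lambda> \<Longrightarrow> w \<in> \<Lambda> \<Longrightarrow> v - w \<in> \<Lambda>"
  using lattice_add[of v "- w"] by auto

lemma lattice_add_iff [simp]: "w \<in> \<Lambda> \<Longrightarrow> z + w \<in> \<Lambda> \<longleftrightarrow> z \<in> \<Lambda>"
  using lattice_add[of z w] lattice_diff[of "z + w" w] by auto

lemma countable_lattice: "countable \<Lambda>"
  unfolding lattice_conv_range by simp

text \<open>The double series is dominated by a product of two single series. Since
  \<open>(1 + \<bar>m\<bar>) (1 + \<bar>n\<bar>)\<close> is at most a constant times
  \<open>norm w ^ 2\<close>, raising to the power \<open>-3/2\<close> gives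
  \<open>norm w ^ 3\<close> in the denominator, and \<open>3/2 > 1\<close> makes each factor
  summable.\<close>

lemma summable_on_lattice_cubes: "(\<lambda>w. 1 / norm w ^ 3) summable_on \<Lambda>"
proof -
  let ?\<phi> = "\<lambda>(m, n). of_int m * a + of_int n * b"
  \<comment> \<open>The shift by 1 matters: \<open>0 powr s = 0\<close>, so without it the product
    would vanish on the coordinate axes and bound nothing there.\<close>
  let ?g = "\<lambda>n::int. (1 + \<bar>of_int n\<bar> :: real) powr (-3/2)"
  obtain c where c: "c > 0" "\<And>x y. norm (of_real x * a + of_real y * b) \<ge> c * sqrt (x\<^sup>2 + y\<^sup>2)"
    using lincomb_lower_bound by metis
  obtain G where G: "(?g has_sum G) UNIV"
    using summable_on_int_powr[of "-3/2"] by (auto simp: summable_on_def)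
  have "(\<lambda>(m, n). ?g m * ?g n) summable_on (UNIV \<times> UNIV)"
  proof (rule summable_on_SigmaI)
    show "((\<lambda>n. case (m, n) of (m, n) \<Rightarrow> ?g m * ?g n) has_sum ?g m * G) UNIV" for m
      using has_sum_cmult_right[OF G, of "?g m"] by simp
    show "(\<lambda>m. ?g m * G) summable_on UNIV"
      by (intro summable_on_cmult_left) (use G in \<open>auto simp: summable_on_def\<close>)
  qed auto
  then have "(\<lambda>(m, n). (2 * c\<^sup>2 / 5) powr (-3/2) * (?g m * ?g n)) summable_on UNIV"
    using summable_on_cmult_right[of "\<lambda>(m, n). ?g m * ?g n" UNIV "(2 * c\<^sup>2 / 5) powr (-3/2)"]
    by (simp add: case_prod_unfold)
  then have "(\<lambda>p. 1 / norm (?\<phi> p) ^ 3) summable_on UNIV"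
  proof (rule summable_on_comparison_test)
    fix p :: "int \<times> int"
    obtain m n where p: "p = (m, n)" by (cases p)
    let ?x = "\<bar>of_int m\<bar> :: real" and ?y = "\<bar>of_int n\<bar> :: real"
    show "1 / norm (?\<phi> p) ^ 3 \<le> (case p of (m, n) \<Rightarrow> (2 * c\<^sup>2 / 5) powr (-3/2) * (?g m * ?g n))"
    proof (cases "p = (0, 0)")
      \<comment> \<open>The lattice point 0 contributes \<open>1 / 0 = 0\<close>.\<close>
      case True
      then show ?thesis by simp
    next
      case False
      have sq: "?x \<le> ?x\<^sup>2" "?y \<le> ?y\<^sup>2"
      proof -
        have "\<bar>k\<bar> \<le> \<bar>k\<bar>\<^sup>2" for k :: int
          using self_le_power[of "\<bar>k\<bar>" 2] by (cases "k = 0") auto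
        then have "of_int \<bar>k\<bar> \<le> (of_int (\<bar>k\<bar>\<^sup>2) :: real)" for k :: int
          using of_int_le_iff by blast
        from this[of m] this[of n] show "?x \<le> ?x\<^sup>2" "?y \<le> ?y\<^sup>2" by simp_all
      qed
      have ge1: "1 \<le> ?x\<^sup>2 + ?y\<^sup>2"
      proof -
        have "m\<^sup>2 + n\<^sup>2 \<noteq> 0" using False p by simp
        then have "1 \<le> m\<^sup>2 + n\<^sup>2" using sum_power2_ge_zero[of m n] by linarith
        then have "of_int 1 \<le> (of_int (m\<^sup>2 + n\<^sup>2) :: real)"
          using of_int_le_iff by blast
        then show ?thesis by simp
      qed
      have "2 * (?x * ?y) \<le> ?x\<^sup>2 + ?y\<^sup>2"
        using sum_squares_bound[of ?x ?y] by simp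
      \<comment> \<open>With \<open>s\<close> the sum of the two squares, the expanded product is
        bounded by \<open>s\<close> for the 1, \<open>s\<close> for the linear part and
        \<open>s / 2\<close> for the mixed term, in total \<open>5/2 * s\<close>.\<close>
      then have "(1 + ?x) * (1 + ?y) \<le> 5 / 2 * (?x\<^sup>2 + ?y\<^sup>2)"
        using sq ge1 by (simp add: algebra_simps)
      then have "(2 * c\<^sup>2 / 5) * ((1 + ?x) * (1 + ?y)) \<le> (2 * c\<^sup>2 / 5) * (5 / 2 * (?x\<^sup>2 + ?y\<^sup>2))"
        using c(1) by (intro mult_left_mono) auto
      also have "\<dots> = (c * sqrt ((of_int m)\<^sup>2 + (of_int n)\<^sup>2))\<^sup>2"
        by (simp add: power_mult_distrib)
      also have "\<dots> \<le> (norm (?\<phi> p))\<^sup>2"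
        using c(2)[of "of_int m" "of_int n"] c(1) unfolding p by (intro power_mono) auto
      finally have le: "(2 * c\<^sup>2 / 5) * ((1 + ?x) * (1 + ?y)) \<le> (norm (?\<phi> p))\<^sup>2" .
      have pos: "0 < (2 * c\<^sup>2 / 5) * ((1 + ?x) * (1 + ?y))"
        using c(1) by (auto intro!: mult_pos_pos)
      then have npos: "norm (?\<phi> p) > 0"
      proof -
        have "0 < (norm (?\<phi> p))\<^sup>2" using le pos by (rule order_less_le_trans[rotated])
        then show ?thesis by simp
      qed
      have "1 / norm (?\<phi> p) ^ 3 = norm (?\<phi> p) powr (-3)"
        unfolding powr_minus_divide by (subst powr_numeral) (use npos in simp_all)
      also have "\<dots> = (norm (?\<phi> p) powr 2) powr (-3/2)"
        by (subst powr_powr) simp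
      also have "\<dots> = ((norm (?\<phi> p))\<^sup>2) powr (-3/2)"
        using powr_numeral[OF less_imp_le[OF npos], of "num.Bit0 num.One"] by (simp only:)
      also have "\<dots> \<le> ((2 * c\<^sup>2 / 5) * ((1 + ?x) * (1 + ?y))) powr (-3/2)"
        by (rule powr_mono2') (use le pos in auto)
      also have "\<dots> = (2 * c\<^sup>2 / 5) powr (-3/2) * (?g m * ?g n)"
      proof -
        have "((1 + ?x) * (1 + ?y)) powr (-3/2) = ?g m * ?g n"
          by (rule powr_mult)
        moreover have "((2 * c\<^sup>2 / 5) * ((1 + ?x) * (1 + ?y))) powr (-3/2) =
            (2 * c\<^sup>2 / 5) powr (-3/2) * ((1 + ?x) * (1 + ?y)) powr (-3/2)"
          by (rule powr_mult)
        ultimately show ?thesis by (simp only:)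
      qed
      finally show ?thesis by (simp add: p)
    qed
  qed auto
  then show ?thesis
    unfolding lattice_conv_range
    by (subst summable_on_reindex[OF lattice_inj]) (simp add: o_def)
qed

lemma finite_lattice_cball: "finite {w \<in> \<Lambda>. norm w \<le> R}"
proof -
  obtain c where c: "c > 0" "\<And>x y. norm (of_real x * a + of_real y * b) \<ge> c * sqrt (x\<^sup>2 + y\<^sup>2)"
    using lincomb_lower_bound by metis
  define N where "N = \<lceil>R / c\<rceil>"
  have "{w \<in> \<Lambda>. norm w \<le> R} \<subseteq> (\<lambda>(m, n). of_int m * a + of_int n * b) ` ({- N..N} \<times> {- N..N})"
  proof
    fix w assume "w \<in> {w \<in> \<Lambda>. norm w \<le> R}"
    then obtain m n where w: "w = of_int m * a + of_int n * b" and R: "norm w \<le> R"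
      by (auto simp: period_lattice_def)
    have "c * sqrt ((of_int m)\<^sup>2 + (of_int n)\<^sup>2) \<le> R"
      using c(2)[of "of_int m" "of_int n"] R w by simp
    then have "sqrt ((of_int m)\<^sup>2 + (of_int n)\<^sup>2) \<le> R / c"
      using c(1) by (simp add: field_simps)
    then have "\<bar>of_int m\<bar> \<le> R / c" "\<bar>of_int n\<bar> \<le> R / c"
      using real_sqrt_sum_squares_ge1[of "of_int m" "of_int n"]
        real_sqrt_sum_squares_ge2[of "of_int n" "of_int m"]
        real_sqrt_ge_abs1[of "of_int m" "of_int n"] real_sqrt_ge_abs2[of "of_int n" "of_int m"]
      by linarith+
    then have "\<bar>m\<bar> \<le> N" "\<bar>n\<bar> \<le> N" unfolding N_def by linarith+
    then show "w \<in> (\<lambda>(m, n). of_int m * a + of_int n * b) ` ({- N..N} \<times> {- N..N})"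
      unfolding w by (auto intro!: image_eqI[of _ _ "(m, n)"])
  qed
  then show ?thesis
    by (rule finite_subset) auto
qed

text \<open>A limit point would have infinitely many lattice points within distance 1. Arbitrary
  subsets are covered because lattice sums are later taken over parts of \<Lambda>, in particular
  without 0.\<close>

lemma closed_lattice_subset:
  assumes "A \<subseteq> \<Lambda>"
  shows "closed A"
proof -
  have "\<not> z islimpt A" for z
  proof
    assume "z islimpt A"
    then have "infinite (A \<inter> ball z 1)"
      by (simp add: islimpt_eq_infinite_ball)
    moreover have "A \<inter> ball z 1 \<subseteq> {w \<in> \<Lambda>. norm w \<le> norm z + 1}"
      using assms by (auto simp: dist_norm) (smt (verit) norm_minus_commute norm_triangle_ineq2 subsetD)
    ultimately show False
      using finite_lattice_cball finite_subset by blast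
  qed
  then show ?thesis
    by (simp add: closed_limpt)
qed

end

section \<open>The Weierstrass function\<close>

lemma deriv_periodic:
  assumes "\<And>z. f (z + w) = f z"
  shows "deriv f (z + w) = deriv f z"
  unfolding deriv_def DERIV_shift using assms by simp

section \<open>Convergence and holomorphy of the lattice sums\<close>

context complex_lattice
begin

text \<open>The index set is a parameter so that a sum can be split into finitely many near terms
  and a uniformly convergent rest, and so that the pole at 0 can be separated from a part that is
  holomorphic there.\<close>

definition "lsum A z = (\<Sum>\<^sub>\<infinity>w\<in>A. 1 / (z - w)\<^sup>2 - 1 / w\<^sup>2)" for A :: "complex set" and z :: complex

abbreviation "\<P> \<equiv> weierstrass_p a b"

text \<open>Subtracting \<open>1 / w^2\<close> gains one power of decay: the difference is
  \<open>z (2 w - z) / ((z - w)^2 w^2)\<close>. For \<open>norm w \<ge> 2 R\<close> one has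
  \<open>norm (z - w) \<ge> norm w / 2\<close> and \<open>norm (2 w - z) \<le> 5/2 * norm w\<close>,
  so the constant is \<open>5/2 * 4 = 10\<close>.\<close>

lemma norm_lsum_term_le:
  fixes z w :: complex
  assumes "R > 0" "norm z \<le> R" "2 * R \<le> norm w"
  shows "norm (1 / (z - w)\<^sup>2 - 1 / w\<^sup>2) \<le> 10 * R * (1 / norm w ^ 3)"
proof -
  let ?n = "norm w"
  have n: "?n > 0" "w \<noteq> 0" using assms by auto
  have "norm w - norm z \<le> norm (z - w)"
    by (metis norm_minus_commute norm_triangle_ineq2)
  then have zw: "?n / 2 \<le> norm (z - w)" using assms by linarith
  then have "z \<noteq> w" using n by auto
  then have "1 / (z - w)\<^sup>2 - 1 / w\<^sup>2 = z * (2 * w - z) / ((z - w)\<^sup>2 * w\<^sup>2)"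
    using n by (simp add: divide_simps) (simp add: power2_eq_square algebra_simps)
  then have "norm (1 / (z - w)\<^sup>2 - 1 / w\<^sup>2) = norm z * norm (2 * w - z) / ((norm (z - w))\<^sup>2 * ?n\<^sup>2)"
    by (simp add: norm_mult norm_divide norm_power)
  also have "\<dots> \<le> R * (5 / 2 * ?n) / ((?n / 2)\<^sup>2 * ?n\<^sup>2)"
  proof (intro frac_le mult_mono power_mono zw order_refl)
    have "norm (2 * w - z) \<le> norm (2 * w) + norm z" by (rule norm_triangle_ineq4)
    then show "norm (2 * w - z) \<le> 5 / 2 * ?n" using assms by (simp add: norm_mult)
  qed (use assms n in auto)
  also have "\<dots> = 10 * R * (1 / ?n ^ 3)"
    using n by (simp add: field_simps power2_eq_square power3_eq_cube)
  finally show ?thesis .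
qed

lemma summable_on_lsum_far:
  assumes "A \<subseteq> \<Lambda>" "R > 0"
  shows "(\<lambda>w. 10 * R * (1 / norm w ^ 3)) summable_on (A - {w \<in> A. norm w < 2 * R})"
  by (intro summable_on_cmult_right summable_on_subset_banach[OF summable_on_lattice_cubes])
     (use assms in auto)

lemma finite_near: "A \<subseteq> \<Lambda> \<Longrightarrow> finite {w \<in> A. norm w < R}"
  by (rule finite_subset[OF _ finite_lattice_cball[of R]]) auto

lemma summable_on_lsum:
  assumes "A \<subseteq> \<Lambda>"
  shows "(\<lambda>w. 1 / (z - w)\<^sup>2 - 1 / w\<^sup>2) summable_on A"
proof -
  define R where "R = norm z + 1"
  define F where "F = {w \<in> A. norm w < 2 * R}"
  have R: "R > 0" "norm z \<le> R" by (auto simp: R_def add_nonneg_pos)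
  have "(\<lambda>w. norm (1 / (z - w)\<^sup>2 - 1 / w\<^sup>2)) summable_on (A - F)"
    unfolding F_def
    by (rule summable_on_comparison_test[OF summable_on_lsum_far[OF assms R(1)]])
       (use R in \<open>auto intro!: norm_lsum_term_le simp del: times_divide_eq_right\<close>)
  then have "(\<lambda>w. 1 / (z - w)\<^sup>2 - 1 / w\<^sup>2) summable_on (A - F)"
    by (rule abs_summable_summable)
  moreover have "(\<lambda>w. 1 / (z - w)\<^sup>2 - 1 / w\<^sup>2) summable_on F"
    using finite_near[OF assms] by (auto simp: F_def intro: summable_on_finite)
  ultimately have "(\<lambda>w. 1 / (z - w)\<^sup>2 - 1 / w\<^sup>2) summable_on (A - F \<union> F)"
    by (rule summable_on_Un_disjoint) auto
  moreover have "A - F \<union> F = A" by (auto simp: F_def)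
  ultimately show ?thesis by simp
qed

text \<open>On a disc of radius \<open>R\<close> the terms with \<open>norm w \<ge> 2 R\<close> have
  no pole and converge uniformly by the M-test, along the filter of finite subsets; the finitely
  many others are added by hand. The discs then exhaust the plane.\<close>

lemma holomorphic_lsum:
  assumes "A \<subseteq> \<Lambda>"
  shows "lsum A holomorphic_on - A"
proof -
  have "lsum A holomorphic_on ball 0 R - A" if "R > 0" for R :: real
  proof -
    define F where "F = {w \<in> A. norm w < 2 * R}"
    have F: "finite F" "F \<subseteq> A" using finite_near[OF assms] by (auto simp: F_def)
    have ulim: "uniform_limit (cball 0 R) (\<lambda>X z. \<Sum>w\<in>X. 1 / (z - w)\<^sup>2 - 1 / w\<^sup>2) (lsum (A - F))
        (finite_subsets_at_top (A - F))"
      unfolding lsum_def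
      by (rule Weierstrass_m_test_general[OF _ summable_on_lsum_far[OF assms that, folded F_def]])
         (use that in \<open>auto intro!: norm_lsum_term_le simp: F_def simp del: times_divide_eq_right\<close>)
    have ev: "\<forall>\<^sub>F X in finite_subsets_at_top (A - F).
        continuous_on (cball 0 R) (\<lambda>z. \<Sum>w\<in>X. 1 / (z - w)\<^sup>2 - 1 / w\<^sup>2) \<and>
        (\<lambda>z. \<Sum>w\<in>X. 1 / (z - w)\<^sup>2 - 1 / w\<^sup>2) holomorphic_on ball 0 R"
    proof (rule eventually_finite_subsets_at_top_weakI)
      fix X assume "finite X" and X: "X \<subseteq> A - F"
      have ne: "z \<noteq> w" if "w \<in> X" "norm z \<le> R" for z w
      proof -
        have "norm w \<ge> 2 * R" "norm z \<le> R"
          using that X by (auto simp: F_def)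
        then show ?thesis using \<open>R > 0\<close> by auto
      qed
      have "(\<lambda>z. \<Sum>w\<in>X. 1 / (z - w)\<^sup>2 - 1 / w\<^sup>2) holomorphic_on cball 0 R"
        by (intro holomorphic_intros) (auto dest: ne)
      then show "continuous_on (cball 0 R) (\<lambda>z. \<Sum>w\<in>X. 1 / (z - w)\<^sup>2 - 1 / w\<^sup>2) \<and>
          (\<lambda>z. \<Sum>w\<in>X. 1 / (z - w)\<^sup>2 - 1 / w\<^sup>2) holomorphic_on ball 0 R"
        using holomorphic_on_imp_continuous_on holomorphic_on_subset ball_subset_cball by blast
    qed
    have "lsum (A - F) holomorphic_on ball 0 R"
      by (rule holomorphic_uniform_limit[OF ev ulim finite_subsets_at_top_neq_bot])
    then have "lsum (A - F) holomorphic_on ball 0 R - A"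
      by (rule holomorphic_on_subset) auto
    moreover have "(\<lambda>z. \<Sum>w\<in>F. 1 / (z - w)\<^sup>2 - 1 / w\<^sup>2) holomorphic_on ball 0 R - A"
      using F by (intro holomorphic_intros) auto
    ultimately have "(\<lambda>z. lsum (A - F) z + (\<Sum>w\<in>F. 1 / (z - w)\<^sup>2 - 1 / w\<^sup>2)) holomorphic_on ball 0 R - A"
      by (rule holomorphic_on_add)
    moreover have "lsum (A - F) z + (\<Sum>w\<in>F. 1 / (z - w)\<^sup>2 - 1 / w\<^sup>2) = lsum A z" for z
    proof -
      have "lsum ((A - F) \<union> F) z = lsum (A - F) z + lsum F z"
        unfolding lsum_def
        by (rule infsum_Un_disjoint) (use assms F in \<open>auto intro!: summable_on_lsum\<close>)
      moreover have "(A - F) \<union> F = A" using F by auto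
      ultimately show ?thesis using F(1) by (simp add: lsum_def)
    qed
    ultimately show ?thesis by simp
  qed
  then have "lsum A holomorphic_on (\<Union>n\<in>(UNIV :: nat set). ball 0 (real (Suc n)) - A)"
    by (intro holomorphic_on_UN_open) (use closed_lattice_subset[OF assms] in auto)
  moreover have "(\<Union>n\<in>(UNIV :: nat set). ball 0 (real (Suc n)) - A) = - A"
  proof -
    have "\<exists>n. norm z < real (Suc n)" for z :: complex
      using reals_Archimedean2[of "norm z"] by (metis less_Suc_eq of_nat_less_iff order_less_trans)
    then show ?thesis by (auto simp del: of_nat_Suc)
  qed
  ultimately show ?thesis by simp
qed

lemma weierstrass_p_conv_lsum: "\<P> z = 1 / z\<^sup>2 + lsum (\<Lambda> - {0}) z"
  by (simp add: weierstrass_p_def lsum_def)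

text \<open>Because \<open>1 / 0 = 0\<close>, the term of \<open>0\<close> need not be treated separately, and this and the
  following identities hold even at the poles.\<close>

lemma weierstrass_p_conv_lsum': "\<P> z = lsum \<Lambda> z"
proof -
  have "lsum (insert 0 (\<Lambda> - {0})) z = 1 / z\<^sup>2 + lsum (\<Lambda> - {0}) z"
    unfolding lsum_def by (subst infsum_insert) (auto intro!: summable_on_lsum)
  then show ?thesis
    by (simp add: weierstrass_p_conv_lsum insert_absorb)
qed

section \<open>Evenness and periodicity\<close>

lemma lsum_even:
  assumes "\<And>w. w \<in> A \<Longrightarrow> - w \<in> A"
  shows "lsum A (- z) = lsum A z"
proof -
  have "bij_betw uminus A A"
    by (rule bij_betwI[of _ _ _ uminus]) (use assms in auto)
  then have "lsum A (- z) = (\<Sum>\<^sub>\<infinity>w\<in>A. 1 / (- z - (- w))\<^sup>2 - 1 / (- w)\<^sup>2)"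
    unfolding lsum_def by (rule infsum_reindex_bij_betw[symmetric])
  also have "\<dots> = lsum A z"
    unfolding lsum_def by (intro infsum_cong) (simp add: power2_commute)
  finally show ?thesis .
qed

lemma weierstrass_p_even: "\<P> (- z) = \<P> z"
  unfolding weierstrass_p_conv_lsum' by (rule lsum_even) simp

text \<open>Shifting the summation index shows that \<open>\<P> (z + w) - \<P> z\<close> does not
  depend on \<open>z\<close>; evenness then determines the constant. No derivative of the series is
  needed.\<close>

lemma weierstrass_p_periodic:
  assumes "w \<in> \<Lambda>"
  shows "\<P> (z + w) = \<P> z"
proof -
  have "bij_betw (\<lambda>v. v + w) \<Lambda> \<Lambda>"
    by (rule bij_betwI[of _ _ _ "\<lambda>v. v - w"]) (use assms in auto)
  then have shift: "((\<lambda>v. f (v + w)) summable_on \<Lambda> \<longleftrightarrow> f summable_on \<Lambda>)"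
      "(\<Sum>\<^sub>\<infinity>v\<in>\<Lambda>. f (v + w)) = (\<Sum>\<^sub>\<infinity>v\<in>\<Lambda>. f v)" for f :: "complex \<Rightarrow> complex"
    by (rule summable_on_reindex_bij_betw, rule infsum_reindex_bij_betw)
  define C where "C = (\<Sum>\<^sub>\<infinity>v\<in>\<Lambda>. 1 / v\<^sup>2 - 1 / (v + w)\<^sup>2)"
  have C: "\<P> (z + w) - \<P> z = C" for z
  proof -
    have 1: "(\<lambda>v. 1 / (z - v)\<^sup>2 - 1 / (v + w)\<^sup>2) summable_on \<Lambda>"
      using shift(1)[of "\<lambda>v. 1 / (z + w - v)\<^sup>2 - 1 / v\<^sup>2"] summable_on_lsum[of \<Lambda> "z + w"] by simp
    \<comment> \<open>Subtracting the series for \<open>\<P> z\<close> from the shifted one cancels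
      the terms containing \<open>z\<close>.\<close>
    have 2: "(\<lambda>v. 1 / v\<^sup>2 - 1 / (v + w)\<^sup>2) summable_on \<Lambda>"
      using summable_on_add[OF 1 summable_on_uminus[THEN iffD2, OF summable_on_lsum[OF order_refl, of z]]]
      by simp
    have "\<P> (z + w) = (\<Sum>\<^sub>\<infinity>v\<in>\<Lambda>. (1 / v\<^sup>2 - 1 / (v + w)\<^sup>2) + (1 / (z - v)\<^sup>2 - 1 / v\<^sup>2))"
      using shift(2)[of "\<lambda>v. 1 / (z + w - v)\<^sup>2 - 1 / v\<^sup>2"]
      by (simp add: weierstrass_p_conv_lsum' lsum_def)
    also have "\<dots> = C + \<P> z"
      unfolding C_def weierstrass_p_conv_lsum' lsum_def
      by (rule infsum_add[OF 2 summable_on_lsum[OF order_refl]])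
    finally show ?thesis by simp
  qed
  \<comment> \<open>The points \<open>- (w / 2)\<close> and \<open>w / 2\<close> differ by
    \<open>w\<close> and are exchanged by negation. They may be lattice points, which is harmless
    since the identity for \<open>C\<close> was shown at every \<open>z\<close>.\<close>
  have "C = 0"
    using C[of "- (w / 2)"] weierstrass_p_even[of "w / 2"] by simp
  then show ?thesis using C[of z] by simp
qed

lemma open_compl_lattice: "open (- \<Lambda>)" "open (- (\<Lambda> - {0}))"
  by (intro open_Compl closed_lattice_subset; blast)+

lemma holomorphic_weierstrass_p: "\<P> holomorphic_on - \<Lambda>"
  using holomorphic_lsum[OF order_refl] by (simp add: weierstrass_p_conv_lsum'[abs_def])

lemma lattice_free_ball:
  obtains r where "r > 0" "ball 0 r \<inter> (\<Lambda> - {0}) = {}"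
proof -
  obtain r where "r > 0" "ball 0 r \<subseteq> - (\<Lambda> - {0})"
    using open_compl_lattice(2) open_contains_ball_eq[of "- (\<Lambda> - {0})"] by (metis ComplI Diff_iff singletonI)
  then show ?thesis by (intro that[of r]) auto
qed

section \<open>Liouville's theorem for doubly periodic functions\<close>

lemma fundamental_parallelogram:
  obtains K where "compact K" "\<And>z. \<exists>w\<in>\<Lambda>. z - w \<in> K"
proof
  let ?f = "\<lambda>(x, y). of_real x * a + of_real y * b"
  have "continuous_on ({0..1} \<times> {0..1}) ?f"
    by (simp add: case_prod_unfold) (intro continuous_intros)
  then show "compact (?f ` ({0..1} \<times> {0..1}))"
    by (intro compact_continuous_image compact_Times) auto
  fix z
  obtain x y where z: "z = of_real x * a + of_real y * b"
    using lincomb_surj by blast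
  have "of_int \<lfloor>x\<rfloor> * a + of_int \<lfloor>y\<rfloor> * b \<in> \<Lambda>"
    by (auto simp: period_lattice_def)
  moreover have "z - (of_int \<lfloor>x\<rfloor> * a + of_int \<lfloor>y\<rfloor> * b) = ?f (frac x, frac y)"
    by (simp add: z frac_def algebra_simps)
  moreover have "(frac x, frac y) \<in> {0..1} \<times> {0..1}"
    by (auto simp: less_imp_le frac_lt_1)
  ultimately show "\<exists>w\<in>\<Lambda>. z - w \<in> ?f ` ({0..1} \<times> {0..1})"
    by (intro bexI) (auto intro: image_eqI)
qed

lemma elliptic_entire_constant:
  assumes "f holomorphic_on UNIV" "\<And>z w. w \<in> \<Lambda> \<Longrightarrow> f (z + w) = f z"
  shows "f constant_on UNIV"
proof (rule Liouville_theorem[OF assms(1)])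
  obtain K where K: "compact K" "\<And>z. \<exists>w\<in>\<Lambda>. z - w \<in> K"
    using fundamental_parallelogram by blast
  have "range f \<subseteq> f ` K"
  proof clarify
    fix z
    obtain w where "w \<in> \<Lambda>" "z - w \<in> K" using K(2) by blast
    then show "f z \<in> f ` K" using assms(2)[of w "z - w"] by force
  qed
  moreover have "compact (f ` K)"
    using K(1) holomorphic_on_imp_continuous_on[OF holomorphic_on_subset[OF assms(1) subset_UNIV]]
    by (rule compact_continuous_image[rotated])
  ultimately show "bounded (range f)"
    using bounded_subset compact_imp_bounded by blast
qed

end

text \<open>Differentiating the equation repeatedly expresses every derivative at \<open>z\<close> through the first two.\<close>

lemma second_order_linear_ode_eq_0:
  fixes w c :: "complex \<Rightarrow> complex"
  assumes "open S" "connected S" "w holomorphic_on S" "c holomorphic_on S"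
    and ode: "\<And>x. x \<in> S \<Longrightarrow> deriv (deriv w) x = c x * w x"
    and z: "z \<in> S" "w z = 0" "deriv w z = 0"
    and "x \<in> S"
  shows "w x = 0"
proof (rule holomorphic_fun_eq_0_on_connected[OF assms(3,1,2) _ z(1) \<open>x \<in> S\<close>])
  fix n show "(deriv ^^ n) w z = 0"
  proof (induction n rule: less_induct)
    case (less n)
    show ?case
    proof (cases "n < 2")
      case True
      then have "n = 0 \<or> n = 1" by auto
      then show ?thesis using z by auto
    next
      case False
      then obtain k where n: "n = k + 2" using le_Suc_ex[of 2 n] by auto
      have "(deriv ^^ n) w z = (deriv ^^ k) (deriv (deriv w)) z"
        unfolding n by (simp add: funpow_swap1)
      also have "\<dots> = (deriv ^^ k) (\<lambda>x. c x * w x) z"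
        by (rule higher_deriv_transform_within_open[OF _ _ \<open>open S\<close> z(1) ode])
           (use assms in \<open>auto intro!: holomorphic_intros\<close>)
      also have "\<dots> = (\<Sum>i = 0..k. of_nat (k choose i) * (deriv ^^ i) c z * (deriv ^^ (k - i)) w z)"
        by (rule higher_deriv_mult[OF assms(4,3,1) z(1)])
      also have "\<dots> = 0"
        by (rule sum.neutral) (use less n in auto)
      finally show ?thesis .
    qed
  qed
qed

lemma has_field_derivative_reflect:
  assumes "(f has_field_derivative D) (at (c - z))"
  shows "((\<lambda>z. f (c - z)) has_field_derivative - D) (at z)"
proof -
  have "((\<lambda>z. c - z) has_field_derivative - 1) (at z)"
    by (auto intro!: derivative_eq_intros)
  from DERIV_chain2[OF assms this] show ?thesis by simp
qed

lemma has_field_derivative_translate: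
  assumes "(f has_field_derivative D) (at (c + z))"
  shows "((\<lambda>z. f (c + z)) has_field_derivative D) (at z)"
proof -
  have "((\<lambda>z. c + z) has_field_derivative 1) (at z)"
    by (auto intro!: derivative_eq_intros)
  from DERIV_chain2[OF assms this] show ?thesis by simp
qed

lemma has_field_derivative_inverse_power:
  fixes z :: complex
  assumes "z \<noteq> 0"
  shows "((\<lambda>z. c / z ^ n) has_field_derivative - (of_nat n * c) / z ^ Suc n) (at z)"
proof -
  have "((\<lambda>z. c * inverse z ^ n) has_field_derivative c * (of_nat n * inverse z ^ (n - 1) * (- (inverse z)\<^sup>2))) (at z)"
    using assms by (auto intro!: derivative_eq_intros simp: power2_eq_square)
  moreover have "c * (of_nat n * inverse z ^ (n - 1) * (- (inverse z)\<^sup>2)) = - (of_nat n * c) / z ^ Suc n"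
    by (cases n) (simp_all add: divide_inverse power2_eq_square power_inverse mult_ac)
  ultimately show ?thesis
    by (simp only: divide_inverse power_inverse)
qed

section \<open>The differential equation of \<P> and the zeros of its derivative\<close>

context complex_lattice
begin

text \<open>Near 0, \<open>\<P> = 1 / z^2 + h\<close> with \<open>h\<close> vanishing to second
  order. In \<open>\<P>'' - 6 \<P>^2\<close> the terms \<open>6 / z^4\<close> cancel, and the cross
  term \<open>12 h / z^2\<close> is holomorphic. The difference therefore extends to an entire
  doubly periodic function, which is constant. Classically the constant is
  \<open>- g2 / 2\<close>.\<close>

lemma weierstrass_p_ode:
  obtains C where "\<And>z. z \<notin> \<Lambda> \<Longrightarrow> deriv (deriv \<P>) z = 6 * (\<P> z)\<^sup>2 + C"
proof -
  obtain r where r: "r > 0" "ball 0 r \<inter> (\<Lambda> - {0}) = {}"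
    using lattice_free_ball .
  define h where "h = lsum (\<Lambda> - {0})"
  have "h holomorphic_on - (\<Lambda> - {0})"
    unfolding h_def by (rule holomorphic_lsum) auto
  then have h: "h holomorphic_on ball 0 r"
    by (rule holomorphic_on_subset) (use r in auto)
  \<comment> \<open>Each summand at 0 is \<open>1 / (0 - w)^2 - 1 / w^2 = 0\<close>.\<close>
  have h0: "h 0 = 0"
    by (simp add: h_def lsum_def)
  have h'0: "deriv h 0 = 0"
  proof -
    have even: "h (- z) = h z" for z
      unfolding h_def by (rule lsum_even) simp
    have "(h has_field_derivative deriv h 0) (at 0)"
      using h r(1) by (meson centre_in_ball holomorphic_derivI open_ball)
    then have "((\<lambda>z. h (- z)) has_field_derivative - deriv h 0) (at 0)"
      using has_field_derivative_reflect[of h "deriv h 0" 0 0] by simp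
    then have "deriv h 0 = - deriv h 0"
      unfolding even by (rule DERIV_imp_deriv)
    then show ?thesis by simp
  qed
  \<comment> \<open>Two successive difference quotients, with derivatives filled in at 0, divide
    \<open>h\<close> by \<open>z^2\<close> without losing holomorphy at 0.\<close>
  define h1 where "h1 = (\<lambda>z. if z = 0 then deriv h 0 else (h z - h 0) / (z - 0))"
  have h1: "h1 holomorphic_on ball 0 r"
    unfolding h1_def by (rule pole_lemma[OF h]) (use r in auto)
  define h2 where "h2 = (\<lambda>z. if z = 0 then deriv h1 0 else (h1 z - h1 0) / (z - 0))"
  have h2: "h2 holomorphic_on ball 0 r"
    unfolding h2_def by (rule pole_lemma[OF h1]) (use r in auto)
  have h2_eq: "h2 z = h z / z\<^sup>2" if "z \<noteq> 0" for z
    using that by (simp add: h2_def h1_def h0 h'0 power2_eq_square)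
  define k where "k = (\<lambda>z. deriv (deriv h) z - 12 * h2 z - 6 * (h z)\<^sup>2)"
  have k: "k holomorphic_on ball 0 r"
    unfolding k_def by (intro holomorphic_intros h h2) auto
  define G where "G = (\<lambda>z. deriv (deriv \<P>) z - 6 * (\<P> z)\<^sup>2)"
  have G: "G holomorphic_on - \<Lambda>"
    unfolding G_def by (intro holomorphic_intros holomorphic_weierstrass_p open_compl_lattice)
  have G_periodic: "G (z + w) = G z" if "w \<in> \<Lambda>" for z w
    unfolding G_def using weierstrass_p_periodic[OF that] by (intro arg_cong2[of _ _ _ _ minus] deriv_periodic) auto
  have P: "\<P> z = 1 / z\<^sup>2 + h z" for z
    by (simp add: h_def weierstrass_p_conv_lsum)
  have G_eq: "G z = k z" if z: "z \<in> ball 0 r - {0}" for z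
  proof -
    have op: "open (ball 0 r - {0 :: complex})" by auto
    have dh: "(h has_field_derivative deriv h z) (at z)" if "z \<in> ball 0 r" for z
      using h that by (meson holomorphic_derivI open_ball)
    have d1: "deriv \<P> z = - 2 / z ^ 3 + deriv h z" if "z \<in> ball 0 r - {0}" for z
    proof (rule DERIV_imp_deriv)
      show "(\<P> has_field_derivative - 2 / z ^ 3 + deriv h z) (at z)"
        unfolding P[abs_def]
        using DERIV_add[OF has_field_derivative_inverse_power[of z 1 2] dh[of z]] that
        by (simp add: numeral_3_eq_3 numeral_2_eq_2)
    qed
    have dh': "(deriv h has_field_derivative deriv (deriv h) z) (at z)"
      using holomorphic_derivI[OF holomorphic_deriv[OF h]] z by auto
    have "((\<lambda>z. - 2 / z ^ 3 + deriv h z) has_field_derivative 6 / z ^ 4 + deriv (deriv h) z) (at z)"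
      using DERIV_add[OF has_field_derivative_inverse_power[of z "-2" 3] dh'] z
      by (simp add: eval_nat_numeral)
    then have "(deriv \<P> has_field_derivative 6 / z ^ 4 + deriv (deriv h) z) (at z)"
      by (rule has_field_derivative_transform_within_open[OF _ op z]) (simp add: d1)
    then have "deriv (deriv \<P>) z = 6 / z ^ 4 + deriv (deriv h) z"
      by (rule DERIV_imp_deriv)
    then show ?thesis
      using z by (simp add: G_def k_def P h2_eq power2_sum power_divide algebra_simps flip: power_mult)
  qed
  \<comment> \<open>The extension over the poles. The cancellation is known only near 0, and
    periodicity transports it to the other lattice points, so the same value \<open>k 0\<close> is
    right at all of them.\<close>
  define E where "E = (\<lambda>z. if z \<in> \<Lambda> then k 0 else G z)"
  have E_periodic: "E (z + w) = E z" if "w \<in> \<Lambda>" for z w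
    using that G_periodic by (simp add: E_def)
  have E_eq: "E z = k (z - w)" if "w \<in> \<Lambda>" "z \<in> ball w r" for z w
  proof -
    have "z - w \<in> ball 0 r" using that by (simp add: dist_norm norm_minus_commute)
    then have "E (z - w) = k (z - w)"
      using r(2) G_eq[of "z - w"] by (cases "z - w = 0") (auto simp: E_def)
    then show ?thesis using E_periodic[OF that(1), of "z - w"] by simp
  qed
  have "E holomorphic_on - \<Lambda> \<union> (\<Union>w\<in>\<Lambda>. ball w r)"
  proof (intro holomorphic_on_Un holomorphic_on_UN_open)
    show "E holomorphic_on - \<Lambda>"
      using G by (rule holomorphic_transform) (auto simp: E_def)
    fix w assume w: "w \<in> \<Lambda>"
    have hol: "(\<lambda>z. z - w) holomorphic_on ball w r"
      by (intro holomorphic_intros)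
    have "(\<lambda>z. z - w) ` ball w r \<subseteq> ball 0 r"
      by (auto simp: dist_norm norm_minus_commute)
    from holomorphic_on_compose_gen[OF hol k this]
    have "(\<lambda>z. k (z - w)) holomorphic_on ball w r"
      by (simp add: o_def)
    then show "E holomorphic_on ball w r"
      by (rule holomorphic_transform) (use E_eq[OF w] in auto)
  qed (use open_compl_lattice in auto)
  moreover have "- \<Lambda> \<union> (\<Union>w\<in>\<Lambda>. ball w r) = UNIV"
    using r(1) by auto
  ultimately have "E constant_on UNIV"
    using E_periodic by (intro elliptic_entire_constant) auto
  then obtain C where C: "\<And>z. E z = C" by (auto simp: constant_on_def)
  show thesis
  proof (rule that)
    show "deriv (deriv \<P>) z = 6 * (\<P> z)\<^sup>2 + C" if "z \<notin> \<Lambda>" for z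
      using C[of z] that by (simp add: E_def G_def algebra_simps)
  qed
qed

text \<open>If \<open>\<P>'\<close> vanishes at \<open>x\<close>, then \<open>\<P> (x + z)\<close> and \<open>\<P> (x - z)\<close> solve the same second order equation
  with the same initial values at \<open>z = 0\<close>, so \<open>2 * x\<close> is a period of \<open>\<P>\<close>; but the pole of \<open>\<P>\<close> at \<open>0\<close> only
  repeats at lattice points.\<close>

lemma deriv_weierstrass_p_eq_0_imp:
  assumes x: "x \<notin> \<Lambda>" and deriv0: "deriv \<P> x = 0"
  shows "2 * x \<in> \<Lambda>"
proof (rule ccontr)
  assume x2: "2 * x \<notin> \<Lambda>"
  obtain C where C: "\<And>z. z \<notin> \<Lambda> \<Longrightarrow> deriv (deriv \<P>) z = 6 * (\<P> z)\<^sup>2 + C"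
    using weierstrass_p_ode by blast
  define S where "S = {z. x + z \<notin> \<Lambda> \<and> x - z \<notin> \<Lambda>}"
  define A where "A = (\<lambda>v. v - x) ` \<Lambda> \<union> (\<lambda>v. x - v) ` \<Lambda>"
  have S_A: "S = UNIV - A"
  proof -
    have "z \<in> (\<lambda>v. v - x) ` \<Lambda> \<longleftrightarrow> x + z \<in> \<Lambda>" for z
      by (auto intro!: image_eqI[of _ _ "x + z"])
    moreover have "z \<in> (\<lambda>v. x - v) ` \<Lambda> \<longleftrightarrow> x - z \<in> \<Lambda>" for z
      by (auto intro!: image_eqI[of _ _ "x - z"])
    ultimately show ?thesis unfolding S_def A_def by blast
  qed
  have "open S"
  proof -
    have "S = (\<lambda>z. x + z) -` (- \<Lambda>) \<inter> (\<lambda>z. x - z) -` (- \<Lambda>)" by (auto simp: S_def)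
    also have "open \<dots>"
      by (intro open_Int open_vimage open_compl_lattice continuous_intros)
    finally show ?thesis .
  qed
  \<comment> \<open>The plane minus a countable set is connected, so agreement near 0 spreads to
    points close to \<open>x\<close>, where \<open>x - z\<close> approaches the pole at 0.\<close>
  have "connected S"
    unfolding S_A by (rule connected_open_diff_countable) (auto simp: A_def countable_lattice)
  define u where "u = (\<lambda>z. \<P> (x + z))"
  define v where "v = (\<lambda>z. \<P> (x - z))"
  have dP: "(\<P> has_field_derivative deriv \<P> z) (at z)" "(deriv \<P> has_field_derivative deriv (deriv \<P>) z) (at z)"
    if "z \<notin> \<Lambda>" for z
    using that holomorphic_derivI[OF holomorphic_weierstrass_p]
      holomorphic_derivI[OF holomorphic_deriv[OF holomorphic_weierstrass_p]] open_compl_lattice by auto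
  have du: "(u has_field_derivative deriv \<P> (x + z)) (at z)"
    and dv: "(v has_field_derivative - deriv \<P> (x - z)) (at z)" if "z \<in> S" for z
    unfolding u_def v_def using that
    by (auto simp: S_def intro!: has_field_derivative_translate has_field_derivative_reflect dP)
  have du2: "((\<lambda>z. deriv \<P> (x + z)) has_field_derivative deriv (deriv \<P>) (x + z)) (at z)"
    and dv2: "((\<lambda>z. - deriv \<P> (x - z)) has_field_derivative deriv (deriv \<P>) (x - z)) (at z)"
    if "z \<in> S" for z
    using that
    by (auto simp: S_def intro!: has_field_derivative_translate dP
      DERIV_minus[OF has_field_derivative_reflect, of "deriv \<P>" "deriv (deriv \<P>) _", simplified])
  have hol: "u holomorphic_on S" "v holomorphic_on S"
    using du dv \<open>open S\<close> by (auto simp: holomorphic_on_open)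
  have d1: "deriv (\<lambda>z. u z - v z) z = deriv \<P> (x + z) - (- deriv \<P> (x - z))" if "z \<in> S" for z
    by (intro DERIV_imp_deriv DERIV_diff du dv that)
  \<comment> \<open>Both \<open>u\<close> and \<open>v\<close> satisfy
    \<open>w'' = 6 w^2 + C\<close>. Their difference solves a linear equation whose coefficient
    \<open>6 (u + v)\<close> is treated as a known function.\<close>
  have eq0: "u z - v z = 0" if "z \<in> S" for z
  proof (rule second_order_linear_ode_eq_0[OF \<open>open S\<close> \<open>connected S\<close> _ _ _ _ _ _ that,
        where c = "\<lambda>z. 6 * (u z + v z)" and z = 0])
    show "(\<lambda>z. u z - v z) holomorphic_on S" "(\<lambda>z. 6 * (u z + v z)) holomorphic_on S"
      by (intro holomorphic_intros hol)+
    show "0 \<in> S" using x by (simp add: S_def)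
    then show "deriv (\<lambda>z. u z - v z) 0 = 0" by (simp add: d1 deriv0)
    show "u 0 - v 0 = 0" by (simp add: u_def v_def)
    fix z assume z: "z \<in> S"
    have "(deriv (\<lambda>z. u z - v z) has_field_derivative deriv (deriv \<P>) (x + z) - deriv (deriv \<P>) (x - z)) (at z)"
      by (rule has_field_derivative_transform_within_open[OF DERIV_diff[OF du2[OF z] dv2[OF z]] \<open>open S\<close> z])
         (simp add: d1)
    then have "deriv (deriv (\<lambda>z. u z - v z)) z = deriv (deriv \<P>) (x + z) - deriv (deriv \<P>) (x - z)"
      by (rule DERIV_imp_deriv)
    also have "\<dots> = 6 * (u z + v z) * (u z - v z)"
      using z by (simp add: S_def C u_def v_def power2_eq_square algebra_simps)
    finally show "deriv (deriv (\<lambda>z. u z - v z)) z = 6 * (u z + v z) * (u z - v z)" .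
  qed
  obtain r where r: "r > 0" "ball 0 r \<inter> (\<Lambda> - {0}) = {}"
    using lattice_free_ball .
  have h: "isCont (lsum (\<Lambda> - {0})) 0"
  proof -
    have "lsum (\<Lambda> - {0}) holomorphic_on - (\<Lambda> - {0})" by (rule holomorphic_lsum) auto
    then show ?thesis
      using continuous_on_eq_continuous_at[OF open_compl_lattice(2)] holomorphic_on_imp_continuous_on
      by blast
  qed
  have "isCont \<P> (2 * x)"
    by (rule DERIV_isCont[OF dP(1)[OF x2]])
  then have "isCont (\<lambda>t. \<P> (2 * x + t)) 0"
    by (intro isCont_o2[of 0 "\<lambda>t. 2 * x + t" \<P>]) simp_all
  then have "((\<lambda>t. \<P> (2 * x + t)) \<longlongrightarrow> \<P> (2 * x)) (at 0)"
    by (simp add: isCont_def)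
  \<comment> \<open>The contradiction: this expression tends to 0 because \<P> is continuous at
    \<open>2 * x\<close>, but \<open>\<P> (2 * x + t) = \<P> (- t)\<close> makes it equal to 1 for
    all small nonzero \<open>t\<close>.\<close>
  then have "((\<lambda>t. t\<^sup>2 * (\<P> (2 * x + t) - lsum (\<Lambda> - {0}) t)) \<longlongrightarrow> 0\<^sup>2 * (\<P> (2 * x) - lsum (\<Lambda> - {0}) 0)) (at 0)"
    by (rule tendsto_mult[OF tendsto_power[OF tendsto_ident_at] tendsto_diff[OF _ h[unfolded isCont_def]]])
  moreover have "\<forall>\<^sub>F t in at 0. t\<^sup>2 * (\<P> (2 * x + t) - lsum (\<Lambda> - {0}) t) = 1"
  proof -
    have "\<forall>\<^sub>F t in at 0. t \<in> ball 0 r \<and> 2 * x + t \<in> - \<Lambda>"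
    proof (intro eventually_conj)
      show "\<forall>\<^sub>F t in at 0. t \<in> ball 0 r" using r(1) by (intro eventually_at_in_open') auto
      have "open ((\<lambda>t. 2 * x + t) -` (- \<Lambda>))"
        by (intro open_vimage open_compl_lattice continuous_intros)
      then have "\<forall>\<^sub>F t in at 0. t \<in> (\<lambda>t. 2 * x + t) -` (- \<Lambda>)"
        using x2 by (intro eventually_at_in_open') auto
      then show "\<forall>\<^sub>F t in at 0. 2 * x + t \<in> - \<Lambda>" by simp
    qed
    moreover have "\<forall>\<^sub>F t in at (0::complex). t \<noteq> 0"
      by (simp add: eventually_at_filter)
    ultimately show ?thesis
    proof eventually_elim
      case (elim t)
      have eq: "x + (x + t) = 2 * x + t" "x - (x + t) = - t" by simp_all
      have "t \<notin> \<Lambda>" using elim r(2) by auto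
      then have "x + t \<in> S" using elim by (simp add: S_def eq)
      then have "\<P> (2 * x + t) = \<P> (- t)"
        using eq0[of "x + t"] by (simp add: u_def v_def eq)
      also have "\<dots> = 1 / t\<^sup>2 + lsum (\<Lambda> - {0}) t"
        by (simp add: weierstrass_p_even) (rule weierstrass_p_conv_lsum)
      finally show ?case
        using elim by simp
    qed
  qed
  then have "((\<lambda>t. t\<^sup>2 * (\<P> (2 * x + t) - lsum (\<Lambda> - {0}) t)) \<longlongrightarrow> 1) (at 0)"
    by (rule tendsto_eventually)
  ultimately have "(0::complex)\<^sup>2 * (\<P> (2 * x) - lsum (\<Lambda> - {0}) 0) = 1"
    by (rule tendsto_unique[rotated]) simp
  then show False by simp
qed

end

section \<open>Linear differential operators\<close>

text \<open>The leading coefficient \<open>g\<close> is left free because the intermediate operators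
  in the iteration are not monic. Indexing coefficients by the order of the derivative suits
  induction under composition.\<close>

definition linear_diff_op_on ::
    "complex set \<Rightarrow> nat \<Rightarrow> (complex \<Rightarrow> complex) \<Rightarrow> foperator \<Rightarrow> bool" where
  "linear_diff_op_on U n g P \<longleftrightarrow>
     (\<exists>c. (\<forall>i. c i holomorphic_on U) \<and> (\<forall>x\<in>U. c n x = g x) \<and>
        (\<forall>f. f holomorphic_on U \<longrightarrow> (\<forall>x\<in>U. P f x = (\<Sum>i\<le>n. c i x * (deriv ^^ i) f x))))"

lemma linear_diff_op_onI:
  assumes "\<And>i. c i holomorphic_on U" "\<And>x. x \<in> U \<Longrightarrow> c n x = g x"
    "\<And>f x. f holomorphic_on U \<Longrightarrow> x \<in> U \<Longrightarrow> P f x = (\<Sum>i\<le>n. c i x * (deriv ^^ i) f x)"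
  shows "linear_diff_op_on U n g P"
  unfolding linear_diff_op_on_def using assms by blast

lemma linear_diff_op_onE:
  assumes "linear_diff_op_on U n g P"
  obtains c where "\<And>i. c i holomorphic_on U" "\<And>x. x \<in> U \<Longrightarrow> c n x = g x"
    "\<And>f x. f holomorphic_on U \<Longrightarrow> x \<in> U \<Longrightarrow> P f x = (\<Sum>i\<le>n. c i x * (deriv ^^ i) f x)"
  using assms unfolding linear_diff_op_on_def by blast

lemma linear_diff_op_on_mult_op:
  assumes "g holomorphic_on U"
  shows "linear_diff_op_on U 0 g (mult_op g)"
  by (rule linear_diff_op_onI[of "\<lambda>_. g"]) (use assms in \<open>auto simp: mult_op_def\<close>)

lemma linear_diff_op_on_mult_left:
  assumes P: "linear_diff_op_on U n g P" and h: "h holomorphic_on U"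
  shows "linear_diff_op_on U n (\<lambda>x. h x * g x) (mult_op h \<circ> P)"
proof -
  obtain c where c: "\<And>i. c i holomorphic_on U" "\<And>x. x \<in> U \<Longrightarrow> c n x = g x"
    "\<And>f x. f holomorphic_on U \<Longrightarrow> x \<in> U \<Longrightarrow> P f x = (\<Sum>i\<le>n. c i x * (deriv ^^ i) f x)"
    using linear_diff_op_onE[OF P] by blast
  show ?thesis
  proof (rule linear_diff_op_onI)
    show "(\<lambda>x. h x * c i x) holomorphic_on U" for i
      by (intro holomorphic_intros h c)
    show "h x * c n x = h x * g x" if "x \<in> U" for x
      using c(2) that by simp
    show "(mult_op h \<circ> P) f x = (\<Sum>i\<le>n. h x * c i x * (deriv ^^ i) f x)"
      if "f holomorphic_on U" "x \<in> U" for f x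
      using c(3) that by (simp add: mult_op_def sum_distrib_left mult.assoc)
  qed
qed

lemma linear_diff_op_on_deriv:
  assumes U: "open U" and P: "linear_diff_op_on U n g P"
  shows "linear_diff_op_on U (Suc n) g (deriv \<circ> P)"
proof -
  obtain c where c: "\<And>i. c i holomorphic_on U" "\<And>x. x \<in> U \<Longrightarrow> c n x = g x"
    "\<And>f x. f holomorphic_on U \<Longrightarrow> x \<in> U \<Longrightarrow> P f x = (\<Sum>i\<le>n. c i x * (deriv ^^ i) f x)"
    using linear_diff_op_onE[OF P] by blast
  \<comment> \<open>Leibniz: the new coefficient of the \<open>i\<close>-th derivative is
    \<open>deriv (c i) + c (i - 1)\<close>. The values of \<open>c\<close> beyond \<open>n\<close>
    are no coefficients of \<open>P\<close>, so the guard removes \<open>deriv (c (Suc n))\<close>,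
    leaving \<open>c n\<close> as the new leading coefficient.\<close>
  define c' where "c' = (\<lambda>i x. (if i \<le> n then deriv (c i) x else 0) + (if i = 0 then 0 else c (i - 1) x))"
  show ?thesis
  proof (rule linear_diff_op_onI)
    show "c' i holomorphic_on U" for i
      unfolding c'_def by (cases "i \<le> n"; cases "i = 0") (auto intro!: holomorphic_intros c U)
    show "c' (Suc n) x = g x" if "x \<in> U" for x
      using c(2) that by (simp add: c'_def)
    fix f x assume f: "f holomorphic_on U" and x: "x \<in> U"
    have d: "((deriv ^^ i) f has_field_derivative (deriv ^^ Suc i) f x) (at x)" for i
      using holomorphic_derivI[OF holomorphic_higher_deriv[OF f U] U x] by simp
    have dc: "(c i has_field_derivative deriv (c i) x) (at x)" for i
      using holomorphic_derivI[OF c(1) U x] .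
    have "((\<lambda>x. \<Sum>i\<le>n. c i x * (deriv ^^ i) f x) has_field_derivative
        (\<Sum>i\<le>n. deriv (c i) x * (deriv ^^ i) f x + (deriv ^^ Suc i) f x * c i x)) (at x)"
      by (intro DERIV_sum DERIV_mult d dc)
    then have "(P f has_field_derivative
        (\<Sum>i\<le>n. deriv (c i) x * (deriv ^^ i) f x + (deriv ^^ Suc i) f x * c i x)) (at x)"
      by (rule has_field_derivative_transform_within_open[OF _ U x]) (simp add: c(3)[OF f])
    then have "deriv (P f) x = (\<Sum>i\<le>n. deriv (c i) x * (deriv ^^ i) f x + (deriv ^^ Suc i) f x * c i x)"
      by (rule DERIV_imp_deriv)
    also have "\<dots> = (\<Sum>i\<le>n. deriv (c i) x * (deriv ^^ i) f x) + (\<Sum>i\<le>n. c i x * (deriv ^^ Suc i) f x)"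
      by (simp add: sum.distrib mult.commute)
    also have "\<dots> = (\<Sum>i\<le>Suc n. (if i \<le> n then deriv (c i) x else 0) * (deriv ^^ i) f x) +
        (\<Sum>i\<le>Suc n. (if i = 0 then 0 else c (i - 1) x) * (deriv ^^ i) f x)"
      by (subst (2) sum.atMost_Suc_shift) simp
    also have "\<dots> = (\<Sum>i\<le>Suc n. c' i x * (deriv ^^ i) f x)"
      by (simp add: c'_def sum.distrib distrib_right)
    finally show "(deriv \<circ> P) f x = (\<Sum>i\<le>Suc n. c' i x * (deriv ^^ i) f x)"
      by simp
  qed
qed

lemma linear_diff_op_on_cong:
  assumes "linear_diff_op_on U n g P" "\<And>x. x \<in> U \<Longrightarrow> g x = h x"
  shows "linear_diff_op_on U n h P"
  using assms unfolding linear_diff_op_on_def by auto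

text \<open>Needed to pass between a test function and its extension by zero outside
  \<open>U\<close>: they are different arguments of \<open>P\<close>, and only the former is given
  as a formula on the whole plane.\<close>

lemma linear_diff_op_on_local:
  assumes U: "open U" and P: "linear_diff_op_on U n g P"
    and f: "f holomorphic_on U" and h: "\<And>x. x \<in> U \<Longrightarrow> f x = h x" and x: "x \<in> U"
  shows "P f x = P h x"
proof -
  have hol: "h holomorphic_on U"
    using f by (rule holomorphic_transform) (rule h)
  have "(deriv ^^ i) f x = (deriv ^^ i) h x" for i
    by (rule higher_deriv_transform_within_open[OF f hol U x h])
  moreover obtain c where "\<And>i. c i holomorphic_on U" "\<And>x. x \<in> U \<Longrightarrow> c n x = g x"
    "\<And>f x. f holomorphic_on U \<Longrightarrow> x \<in> U \<Longrightarrow> P f x = (\<Sum>i\<le>n. c i x * (deriv ^^ i) f x)"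
    using linear_diff_op_onE[OF P] by blast
  ultimately show ?thesis
    using f hol x by simp
qed

lemma monic_diff_op_on_iff_linear_diff_op_on:
  "monic_diff_op_on U n L \<longleftrightarrow> linear_diff_op_on U n (\<lambda>_. 1) L"
proof
  have reindex: "(\<Sum>i\<le>n. b i) = b n + (\<Sum>i = 1..n. b (n - i))" for b :: "nat \<Rightarrow> complex"
  proof -
    have "(\<Sum>i\<le>n. b i) = (\<Sum>i\<le>n. b (n - i))"
      by (rule sum.reindex_bij_witness[of _ "\<lambda>i. n - i" "\<lambda>i. n - i"]) auto
    also have "\<dots> = b n + (\<Sum>i = 1..n. b (n - i))"
      by (simp add: atMost_atLeast0 sum.atLeast_Suc_atMost)
    finally show ?thesis .
  qed
  {
    assume "linear_diff_op_on U n (\<lambda>_. 1) L"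
    then obtain c where c: "\<And>i. c i holomorphic_on U" "\<And>x. x \<in> U \<Longrightarrow> c n x = 1"
      "\<And>f x. f holomorphic_on U \<Longrightarrow> x \<in> U \<Longrightarrow> L f x = (\<Sum>i\<le>n. c i x * (deriv ^^ i) f x)"
      using linear_diff_op_onE by blast
    then show "monic_diff_op_on U n L"
      unfolding monic_diff_op_on_def operators_eq_on_def
      by (intro exI[of _ "\<lambda>i. c (n - i)"]) (simp add: reindex)
  next
    assume "monic_diff_op_on U n L"
    then obtain c where c: "\<And>i. i \<in> {1..n} \<Longrightarrow> c i holomorphic_on U"
      "\<And>f x. f holomorphic_on U \<Longrightarrow> x \<in> U \<Longrightarrow>
         L f x = (deriv ^^ n) f x + (\<Sum>i = 1..n. c i x * (deriv ^^ (n - i)) f x)"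
      unfolding monic_diff_op_on_def operators_eq_on_def by blast
    \<comment> \<open>The given \<open>c i\<close> are known to be holomorphic only for
      \<open>1 \<le> i \<le> n\<close>. The constant 1 is both the leading coefficient and a
      holomorphic filler above \<open>n\<close>.\<close>
    define b where "b = (\<lambda>i. if i < n then c (n - i) else (\<lambda>_. 1))"
    show "linear_diff_op_on U n (\<lambda>_. 1) L"
    proof (rule linear_diff_op_onI[of b])
      show "b i holomorphic_on U" for i
        by (cases "i < n") (auto simp: b_def intro!: c)
      show "L f x = (\<Sum>i\<le>n. b i x * (deriv ^^ i) f x)" if "f holomorphic_on U" "x \<in> U" for f x
      proof -
        have "(\<Sum>i = 1..n. b (n - i) x * (deriv ^^ (n - i)) f x) = (\<Sum>i = 1..n. c i x * (deriv ^^ (n - i)) f x)"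
          by (rule sum.cong) (auto simp: b_def)
        then show ?thesis
          using c(2)[OF that] by (simp add: reindex) (simp add: b_def)
      qed
    qed (simp add: b_def)
  }
qed

section \<open>Orders of vanishing and uniqueness of the coefficients\<close>

text \<open>The derivative of \<open>g s^(k+1)\<close> is \<open>(g' s + (k+1) g s') s^k\<close>,
  again a holomorphic function times a power of \<open>s\<close>. Hence the induction generalises
  over \<open>g\<close>; at \<open>x\<close> the new factor is \<open>(k+1) g s'\<close> because
  \<open>s x = 0\<close>.\<close>

lemma higher_deriv_mult_power_at_zero:
  assumes U: "open U" and s: "s holomorphic_on U" and x: "x \<in> U" "s x = 0"
    and g: "g holomorphic_on U"
  shows "(\<forall>j<k. (deriv ^^ j) (\<lambda>y. g y * s y ^ k) x = 0) \<and>
    (deriv ^^ k) (\<lambda>y. g y * s y ^ k) x = fact k * g x * deriv s x ^ k"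
  using g
proof (induction k arbitrary: g)
  case 0
  then show ?case by simp
next
  case (Suc k)
  define g' where "g' = (\<lambda>y. deriv g y * s y + of_nat (Suc k) * g y * deriv s y)"
  have g': "g' holomorphic_on U"
    unfolding g'_def by (intro holomorphic_intros Suc.prems s U)
  have "deriv (\<lambda>y. g y * s y ^ Suc k) y = g' y * s y ^ k" if y: "y \<in> U" for y
  proof (rule DERIV_imp_deriv)
    have ds: "(s has_field_derivative deriv s y) (at y)" "(g has_field_derivative deriv g y) (at y)"
      using holomorphic_derivI[OF s U y] holomorphic_derivI[OF Suc.prems U y] .
    show "((\<lambda>y. g y * s y ^ Suc k) has_field_derivative g' y * s y ^ k) (at y)"
      using DERIV_mult[OF ds(2) DERIV_power[OF ds(1), of "Suc k"]]
      by (simp add: g'_def algebra_simps)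
  qed
  then have shift: "(deriv ^^ Suc j) (\<lambda>y. g y * s y ^ Suc k) x = (deriv ^^ j) (\<lambda>y. g' y * s y ^ k) x" for j
    unfolding funpow_Suc_right o_apply
    by (intro higher_deriv_transform_within_open[OF _ _ U x(1)])
       (auto intro!: holomorphic_intros Suc.prems s U g')
  have "(deriv ^^ j) (\<lambda>y. g y * s y ^ Suc k) x = 0" if "j < Suc k" for j
  proof (cases j)
    case 0
    then show ?thesis using x by simp
  next
    case (Suc i)
    then show ?thesis using shift[of i] Suc.IH[OF g'] that by simp
  qed
  moreover have "(deriv ^^ Suc k) (\<lambda>y. g y * s y ^ Suc k) x = fact (Suc k) * g x * deriv s x ^ Suc k"
    unfolding shift using Suc.IH[OF g'] x by (simp add: g'_def algebra_simps)
  ultimately show ?case by blast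
qed

text \<open>Since \<open>\<Phi> (p - p x)^k\<close> vanishes at \<open>x\<close> to order exactly \<open>k\<close>, testing against it with \<open>k\<close> running
  downwards from \<open>n - 1\<close> identifies the coefficients one after the other.\<close>

lemma linear_diff_op_on_unique:
  assumes U: "open U" and p: "p holomorphic_on U" "\<And>x. x \<in> U \<Longrightarrow> deriv p x \<noteq> 0"
    and \<Phi>: "\<Phi> holomorphic_on U" "\<And>x. x \<in> U \<Longrightarrow> \<Phi> x \<noteq> 0"
    and P: "linear_diff_op_on U n g P" and Q: "linear_diff_op_on U n g Q"
    and eq: "\<And>k x. k < n \<Longrightarrow> x \<in> U \<Longrightarrow>
      P (\<lambda>y. \<Phi> y * (p y - p x) ^ k) x = Q (\<lambda>y. \<Phi> y * (p y - p x) ^ k) x"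
  shows "operators_eq_on U P Q"
  unfolding operators_eq_on_def
proof (intro allI impI ballI)
  fix f x assume f: "f holomorphic_on U" and x: "x \<in> U"
  obtain b where b: "\<And>i. b i holomorphic_on U" "\<And>x. x \<in> U \<Longrightarrow> b n x = g x"
    "\<And>f x. f holomorphic_on U \<Longrightarrow> x \<in> U \<Longrightarrow> P f x = (\<Sum>i\<le>n. b i x * (deriv ^^ i) f x)"
    using linear_diff_op_onE[OF P] by blast
  obtain c where c: "\<And>i. c i holomorphic_on U" "\<And>x. x \<in> U \<Longrightarrow> c n x = g x"
    "\<And>f x. f holomorphic_on U \<Longrightarrow> x \<in> U \<Longrightarrow> Q f x = (\<Sum>i\<le>n. c i x * (deriv ^^ i) f x)"
    using linear_diff_op_onE[OF Q] by blast
  have "b k x = c k x" if "k \<le> n" for k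
    using that
  proof (induction "n - k" arbitrary: k rule: less_induct)
    case less
    show ?case
    proof (cases "k = n")
      case True
      then show ?thesis using b(2) c(2) x by simp
    next
      case False
      define F where "F = (\<lambda>y. \<Phi> y * (p y - p x) ^ k)"
      have "F holomorphic_on U"
        unfolding F_def by (intro holomorphic_intros \<Phi> p)
      then have "(\<Sum>i\<le>n. (b i x - c i x) * (deriv ^^ i) F x) = 0"
        using eq[of k x] b(3) c(3) x False less.prems
        by (simp add: F_def[symmetric] left_diff_distrib sum_subtractf)
      moreover have dF: "(\<forall>j<k. (deriv ^^ j) F x = 0) \<and> (deriv ^^ k) F x = fact k * \<Phi> x * deriv (\<lambda>y. p y - p x) x ^ k"
        unfolding F_def
        by (rule higher_deriv_mult_power_at_zero[OF U _ x]) (auto intro!: holomorphic_intros p \<Phi>)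
      \<comment> \<open>Below \<open>k\<close> the derivative of \<open>F\<close> vanishes, above
        \<open>k\<close> the coefficients already agree.\<close>
      have "(b i x - c i x) * (deriv ^^ i) F x = 0" if "i \<in> {..n} - {k}" for i
      proof (cases "i < k")
        case False
        then have "k < i" "i \<le> n" using that by auto
        then show ?thesis using less.hyps[of i] by (simp add: diff_less_mono2)
      qed (use dF in simp)
      then have "(\<Sum>i\<in>{..n} - {k}. (b i x - c i x) * (deriv ^^ i) F x) = 0"
        by (rule sum.neutral[OF ballI])
      then have "(\<Sum>i\<le>n. (b i x - c i x) * (deriv ^^ i) F x) = (b k x - c k x) * (deriv ^^ k) F x"
        using less.prems by (simp add: sum.remove[of _ k])
      ultimately have "(b k x - c k x) * (deriv ^^ k) F x = 0" by simp
      moreover have "deriv (\<lambda>y. p y - p x) x = deriv p x"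
        using DERIV_diff[OF holomorphic_derivI[OF p(1) U x] DERIV_const] by (simp add: DERIV_imp_deriv)
      ultimately show ?thesis using dF \<Phi>(2)[OF x] p(2)[OF x] by simp
    qed
  qed
  then show "P f x = Q f x"
    using b(3)[OF f x] c(3)[OF f x] by simp
qed

section \<open>Iterates of differentiation with respect to a function\<close>

lemma linear_diff_op_on_iterate:
  assumes U: "open U" and q: "q holomorphic_on U" and g: "g holomorphic_on U"
  shows "linear_diff_op_on U n (\<lambda>x. q x ^ n * g x) (((mult_op q \<circ> deriv) ^^ n) \<circ> mult_op g)"
proof (induction n)
  case 0
  then show ?case using linear_diff_op_on_mult_op[OF g] by simp
next
  case (Suc n)
  show ?case
    using linear_diff_op_on_mult_left[OF linear_diff_op_on_deriv[OF U Suc.IH] q]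
    by (simp only: funpow.simps o_assoc power_Suc mult.assoc)
qed

text \<open>By the chain rule \<open>(1 / p') d/dx\<close> is differentiation with respect to
  \<open>p\<close>. Agreement of \<open>f\<close> with the polynomial is asked for only on
  \<open>U\<close>, so that functions cut off outside \<open>U\<close> are covered.\<close>

lemma iterate_deriv_poly_compose:
  assumes U: "open U" and p: "p holomorphic_on U" "\<And>x. x \<in> U \<Longrightarrow> deriv p x \<noteq> 0"
    and f: "\<And>x. x \<in> U \<Longrightarrow> f x = poly r (p x)" and x: "x \<in> U"
  shows "((mult_op (\<lambda>x. 1 / deriv p x) \<circ> deriv) ^^ n) f x = poly ((pderiv ^^ n) r) (p x)"
proof -
  define D where "D = mult_op (\<lambda>x. 1 / deriv p x) \<circ> deriv"
  have "(D ^^ n) f x = poly ((pderiv ^^ n) r) (p x)"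
    using x
  proof (induction n arbitrary: x)
    case 0
    then show ?case using f by simp
  next
    case (Suc n)
    have "((\<lambda>x. poly ((pderiv ^^ n) r) (p x)) has_field_derivative
        poly (pderiv ((pderiv ^^ n) r)) (p x) * deriv p x) (at x)"
      by (rule DERIV_chain2[OF poly_DERIV holomorphic_derivI[OF p(1) U Suc.prems]])
    then have "((D ^^ n) f has_field_derivative poly (pderiv ((pderiv ^^ n) r)) (p x) * deriv p x) (at x)"
      by (rule has_field_derivative_transform_within_open[OF _ U Suc.prems]) (simp add: Suc.IH)
    then have "deriv ((D ^^ n) f) x = poly (pderiv ((pderiv ^^ n) r)) (p x) * deriv p x"
      by (rule DERIV_imp_deriv)
    moreover have "D h x = deriv h x / deriv p x" for h
      by (simp add: D_def mult_op_def)
    ultimately show ?case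
      using p(2)[OF Suc.prems] by simp
  qed
  then show ?thesis by (simp only: D_def)
qed

lemma pderiv_iterate_eq_0:
  fixes r :: "complex poly"
  assumes "degree r < n"
  shows "(pderiv ^^ n) r = 0"
  using assms
proof (induction n arbitrary: r)
  case (Suc n)
  show ?case
  proof (cases "degree r = 0")
    case True
    then have "pderiv r = 0" by (simp add: pderiv_eq_0_iff)
    then show ?thesis by (simp add: funpow_swap1)
  next
    case False
    then have "degree (pderiv r) < n" using Suc.prems by (simp add: degree_pderiv)
    then show ?thesis using Suc.IH[of "pderiv r"] by (simp add: funpow_swap1)
  qed
qed simp

section \<open>The span of the powers\<close>

lemma sum_fun_apply: "(\<Sum>i\<in>A. f i) x = (\<Sum>i\<in>A. f i x)"
  by (induction A rule: infinite_finite_induct) auto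

text \<open>With polynomials in place of linear combinations, annihilation by \<open>d + 1\<close>
  derivatives and membership of the shifted powers \<open>(q - q x)^k\<close> both become degree
  statements.\<close>

lemma power_span_eq:
  "power_span U \<phi> q d =
     {f. \<exists>r. degree r \<le> d \<and> f = (\<lambda>x. if x \<in> U then \<phi> x * poly r (q x) else 0)}"
    (is "_ = ?R")
proof
  have "cfun.subspace ?R"
  proof (rule cfun.subspaceI)
    show "0 \<in> ?R"
      by (rule CollectI, rule exI[of _ 0]) (auto simp: fun_eq_iff)
  next
    fix f g assume "f \<in> ?R" "g \<in> ?R"
    then obtain r s where "degree r \<le> d" "f = (\<lambda>x. if x \<in> U then \<phi> x * poly r (q x) else 0)"
      "degree s \<le> d" "g = (\<lambda>x. if x \<in> U then \<phi> x * poly s (q x) else 0)" by blast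
    then show "f + g \<in> ?R"
      by (intro CollectI exI[of _ "r + s"]) (auto simp: fun_eq_iff degree_add_le algebra_simps)
  next
    fix c :: complex and f assume "f \<in> ?R"
    then obtain r where "degree r \<le> d" "f = (\<lambda>x. if x \<in> U then \<phi> x * poly r (q x) else 0)" by blast
    then show "(\<lambda>x. c * f x) \<in> ?R"
      by (intro CollectI exI[of _ "smult c r"]) (auto simp: fun_eq_iff)
  qed
  moreover have "(\<lambda>n x. if x \<in> U then \<phi> x * q x ^ n else 0) ` {0..d} \<subseteq> ?R"
  proof clarify
    fix n assume "n \<in> {0..d}"
    then show "\<exists>r. degree r \<le> d \<and> (\<lambda>x. if x \<in> U then \<phi> x * q x ^ n else 0) = (\<lambda>x. if x \<in> U then \<phi> x * poly r (q x) else 0)"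
      by (intro exI[of _ "monom 1 n"]) (auto simp: poly_monom degree_monom_eq)
  qed
  ultimately show "power_span U \<phi> q d \<subseteq> ?R"
    unfolding power_span_def by (intro cfun.span_minimal)
next
  show "?R \<subseteq> power_span U \<phi> q d"
  proof clarify
    fix r :: "complex poly" assume r: "degree r \<le> d"
    have "poly r z = (\<Sum>i\<le>d. coeff r i * z ^ i)" for z
      unfolding poly_altdef using r
      by (intro sum.mono_neutral_left) (auto simp: coeff_eq_0)
    then have "(\<lambda>x. if x \<in> U then \<phi> x * poly r (q x) else 0) =
        (\<Sum>i\<le>d. (\<lambda>x. coeff r i * (if x \<in> U then \<phi> x * q x ^ i else 0)))"
      by (auto simp: fun_eq_iff sum_fun_apply sum_distrib_left mult_ac)
    also have "\<dots> \<in> power_span U \<phi> q d"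
      unfolding power_span_def
      by (intro cfun.span_sum cfun.span_scale cfun.span_base imageI) auto
    finally show "(\<lambda>x. if x \<in> U then \<phi> x * poly r (q x) else 0) \<in> power_span U \<phi> q d" .
  qed
qed

lemma dim_power_span:
  assumes inf: "infinite (q ` U)" and \<phi>: "\<And>x. x \<in> U \<Longrightarrow> \<phi> x \<noteq> 0"
  shows "cfun.dim (power_span U \<phi> q d) = d + 1"
proof -
  let ?b = "\<lambda>n x. if x \<in> U then \<phi> x * q x ^ n else 0"
  have zero: "u i = 0" if "\<And>x. (\<Sum>i\<in>{0..d}. u i * ?b i x) = 0" "i \<in> {0..d}" for u i
  proof -
    define r where "r = (\<Sum>i\<in>{0..d}. monom (u i) i)"
    have "poly r (q x) = 0" if x: "x \<in> U" for x
    proof -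
      have "\<phi> x * poly r (q x) = (\<Sum>i\<in>{0..d}. u i * ?b i x)"
        using x by (simp add: r_def poly_sum poly_monom sum_distrib_left mult_ac)
      then show ?thesis using \<open>\<And>x. (\<Sum>i\<in>{0..d}. u i * ?b i x) = 0\<close> \<phi>[OF x] by simp
    qed
    then have "q ` U \<subseteq> {z. poly r z = 0}" by auto
    then have "r = 0" using inf poly_roots_finite finite_subset by blast
    moreover have "coeff r i = u i"
      using \<open>i \<in> {0..d}\<close> by (simp add: r_def coeff_sum)
    ultimately show ?thesis by simp
  qed
  \<comment> \<open>The span is that of an image set, in which equal generators would be counted
    once. Two equal generators would give a relation with coefficients 1 and -1.\<close>
  have inj: "inj_on ?b {0..d}"
  proof (rule inj_onI, rule ccontr)
    fix i j assume ij: "i \<in> {0..d}" "j \<in> {0..d}" "?b i = ?b j" "i \<noteq> j"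
    define u where "u = (\<lambda>k. if k = i then 1 else if k = j then - 1 else 0 :: complex)"
    have "(\<Sum>k\<in>{0..d}. u k * ?b k x) = 0" for x
    proof -
      have "(\<Sum>k\<in>{0..d}. u k * ?b k x) = (\<Sum>k\<in>{i, j}. u k * ?b k x)"
        by (rule sum.mono_neutral_right) (use ij in \<open>auto simp: u_def\<close>)
      also have "\<dots> = ?b i x - ?b j x" using ij(4) by (simp add: u_def)
      finally show ?thesis using fun_cong[OF ij(3), of x] by simp
    qed
    from zero[OF this ij(1)] show False by (simp add: u_def)
  qed
  have "cfun.independent (?b ` {0..d})"
  proof
    assume "cfun.dependent (?b ` {0..d})"
    then obtain u v where uv: "v \<in> ?b ` {0..d}" "u v \<noteq> 0"
      "(\<Sum>v\<in>?b ` {0..d}. (\<lambda>x. u v * v x)) = 0"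
      by (auto simp: cfun.dependent_finite)
    have "(\<Sum>i\<in>{0..d}. u (?b i) * ?b i x) = 0" for x
      using fun_cong[OF uv(3), of x] by (simp add: sum.reindex[OF inj] sum_fun_apply)
    then show False using zero[of "\<lambda>i. u (?b i)"] uv(1,2) by auto
  qed
  then have "cfun.dim (power_span U \<phi> q d) = card (?b ` {0..d})"
    unfolding power_span_def by (rule cfun.dim_span_eq_card_independent)
  then show ?thesis by (simp add: card_image[OF inj])
qed

text \<open>Holomorphy is local, so logarithms on small balls suffice even when \<open>U\<close>
  admits no global one.\<close>

lemma power_branch_on_holomorphic:
  assumes "power_branch_on U g a p"
  shows "p holomorphic_on U"
proof -
  have "p analytic_on U"
    unfolding analytic_on_def
  proof
    fix x assume "x \<in> U"
    then obtain r h where r: "r > 0" "h holomorphic_on ball x r" "\<forall>y\<in>ball x r. p y = exp (a * h y)"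
      using assms unfolding power_branch_on_def by metis
    have "(\<lambda>y. exp (a * h y)) holomorphic_on ball x r"
      by (intro holomorphic_intros r)
    then have "p holomorphic_on ball x r"
      by (rule holomorphic_transform) (use r in auto)
    then show "\<exists>e>0. p holomorphic_on ball x e" using r by blast
  qed
  then show ?thesis by (rule analytic_imp_holomorphic)
qed

section \<open>The annihilating operator\<close>

text \<open>The definite article in "the monic operator" is rendered by existence together with
  agreement of every annihilator with the explicit operator; existence keeps the second claim from
  being vacuous.\<close>

theorem mainTheorem1:
  fixes \<omega> e l \<alpha> :: "nat \<Rightarrow> complex"
    and \<P> \<Phi> :: "complex \<Rightarrow> complex"
    and pow_pos pow_neg :: "nat \<Rightarrow> complex \<Rightarrow> complex"
    and d :: nat and U :: "complex set" and V :: "(complex \<Rightarrow> complex) set"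
  assumes periods: "2 * \<omega> 1 \<noteq> 2 * \<omega> 3" "independent {2 * \<omega> 1, 2 * \<omega> 3}"
    and omega2: "\<omega> 2 = - \<omega> 1 - \<omega> 3"
    and wp: "\<P> = weierstrass_p (2 * \<omega> 1) (2 * \<omega> 3)"
    and e: "\<And>i. i \<in> {1..3} \<Longrightarrow> e i = \<P> (\<omega> i)"
    and alpha: "\<And>i. i \<in> {0..3} \<Longrightarrow> \<alpha> i = - l i \<or> \<alpha> i = l i + 1"
    and d: "of_nat d = - (\<Sum>i = 0..3. \<alpha> i / 2)"
    and U: "open U" "connected U" "U \<noteq> {}" "U \<inter> period_lattice (\<omega> 1) (\<omega> 3) = {}"
    and pow_pos: "\<And>i. i \<in> {1..3} \<Longrightarrow> power_branch_on U (\<lambda>x. \<P> x - e i) (\<alpha> i / 2) (pow_pos i)"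
    and pow_neg: "\<And>i. i \<in> {1..3} \<Longrightarrow> power_branch_on U (\<lambda>x. \<P> x - e i) (- \<alpha> i / 2) (pow_neg i)"
    and consistent: "\<And>i x. i \<in> {1..3} \<Longrightarrow> x \<in> U \<Longrightarrow> pow_pos i x * pow_neg i x = 1"
    and Phi: "\<Phi> = (\<lambda>x. \<Prod>i = 1..3. pow_pos i x)"
    and V: "V = power_span U \<Phi> \<P> d"
  shows "cfun.dim V = d + 1 \<and>
    (\<exists>L. monic_annihilator_on U (d + 1) V L) \<and>
    (\<forall>L. monic_annihilator_on U (d + 1) V L \<longrightarrow>
      operators_eq_on U
        (mult_op (\<lambda>x. deriv \<P> x ^ (d + 1) * (\<Prod>i = 1..3. pow_pos i x))
          \<circ> ((mult_op (\<lambda>x. 1 / deriv \<P> x) \<circ> deriv) ^^ (d + 1))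
          \<circ> mult_op (\<lambda>x. \<Prod>i = 1..3. pow_neg i x))
        L)"
proof -
  interpret complex_lattice "2 * \<omega> 1" "2 * \<omega> 3"
    using periods by unfold_locales
  \<comment> \<open>\<open>U\<close> avoids the lattice of half-periods, whereas \<Lambda> is
    generated by the full periods; doubling translates between the two.\<close>
  have notin: "x \<notin> \<Lambda>" "2 * x \<notin> \<Lambda>" if "x \<in> U" for x
  proof -
    have "x \<in> period_lattice (\<omega> 1) (\<omega> 3)" if per: "2 * x \<in> \<Lambda>"
    proof -
      obtain m n where "2 * x = of_int m * (2 * \<omega> 1) + of_int n * (2 * \<omega> 3)"
        using per unfolding period_lattice_def by blast
      then have "2 * x = 2 * (of_int m * \<omega> 1 + of_int n * \<omega> 3)"
        by (simp only: distrib_left mult.left_commute)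
      then have "x = of_int m * \<omega> 1 + of_int n * \<omega> 3"
        by (rule iffD1[OF mult_left_cancel, rotated]) simp
      then show ?thesis by (auto simp: period_lattice_def)
    qed
    with U(4) \<open>x \<in> U\<close> show "2 * x \<notin> \<Lambda>" by blast
    then show "x \<notin> \<Lambda>" using lattice_add[of x x] by (simp only: mult_2) blast
  qed
  have hol: "\<P> holomorphic_on U"
    unfolding wp using holomorphic_weierstrass_p by (rule holomorphic_on_subset) (use notin in auto)
  have deriv_nz: "deriv \<P> x \<noteq> 0" if "x \<in> U" for x
    using deriv_weierstrass_p_eq_0_imp notin[OF that] by (auto simp: wp)
  define \<Psi> where "\<Psi> = (\<lambda>x. \<Prod>i = 1..3. pow_neg i x)"
  have hol_\<Phi>: "\<Phi> holomorphic_on U" and hol_\<Psi>: "\<Psi> holomorphic_on U"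
    unfolding Phi \<Psi>_def
    by (intro holomorphic_on_prod power_branch_on_holomorphic[OF pow_pos] power_branch_on_holomorphic[OF pow_neg]; simp)+
  have \<Phi>\<Psi>: "\<Phi> x * \<Psi> x = 1" if "x \<in> U" for x
    using consistent that by (simp add: Phi \<Psi>_def flip: prod.distrib)
  then have \<Phi>_nz: "\<Phi> x \<noteq> 0" if "x \<in> U" for x
    using that by force
  define T where "T = mult_op (\<lambda>x. deriv \<P> x ^ (d + 1) * \<Phi> x)
    \<circ> ((mult_op (\<lambda>x. 1 / deriv \<P> x) \<circ> deriv) ^^ (d + 1)) \<circ> mult_op \<Psi>"
  have T_monic: "linear_diff_op_on U (d + 1) (\<lambda>_. 1) T"
  proof (rule linear_diff_op_on_cong)
    show "linear_diff_op_on U (d + 1)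
        (\<lambda>x. (deriv \<P> x ^ (d + 1) * \<Phi> x) * ((1 / deriv \<P> x) ^ (d + 1) * \<Psi> x)) T"
      \<comment> \<open>Right association joins \<open>mult_op \<Psi>\<close> to the iterate, the
        form treated by \<open>linear_diff_op_on_iterate\<close>.\<close>
      unfolding T_def o_assoc[symmetric]
      by (intro linear_diff_op_on_mult_left linear_diff_op_on_iterate holomorphic_intros
          hol hol_\<Phi> hol_\<Psi> U(1) deriv_nz)
    show "(deriv \<P> x ^ (d + 1) * \<Phi> x) * ((1 / deriv \<P> x) ^ (d + 1) * \<Psi> x) = 1" if "x \<in> U" for x
      using \<Phi>\<Psi>[OF that] deriv_nz[OF that] by (simp add: power_divide field_simps)
  qed
  \<comment> \<open>Stated for every \<open>f\<close> of this form on \<open>U\<close>, whatever its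
    values elsewhere: it is applied both to elements of \<open>V\<close> and to test functions that
    are not cut off.\<close>
  have T_0: "T f x = 0" if r: "degree r \<le> d" "\<And>y. y \<in> U \<Longrightarrow> f y = \<Phi> y * poly r (\<P> y)" and x: "x \<in> U" for f r x
  proof -
    have "mult_op \<Psi> f y = poly r (\<P> y)" if "y \<in> U" for y
      using r(2)[OF that] \<Phi>\<Psi>[OF that] by (simp add: mult_op_def algebra_simps)
    from iterate_deriv_poly_compose[OF U(1) hol deriv_nz this x, of "d + 1"]
    have "((mult_op (\<lambda>x. 1 / deriv \<P> x) \<circ> deriv) ^^ (d + 1)) (mult_op \<Psi> f) x = 0"
      using pderiv_iterate_eq_0[of r "d + 1"] r(1) by (simp del: funpow.simps)
    moreover have "mult_op g h x = g x * h x" for g h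
      by (simp add: mult_op_def)
    ultimately show ?thesis
      unfolding T_def by (simp del: funpow.simps)
  qed
  \<comment> \<open>A finite connected image would be a single point, forcing
    \<open>deriv \<P> = 0\<close> on \<open>U\<close>.\<close>
  have "infinite (\<P> ` U)"
  proof
    assume "finite (\<P> ` U)"
    moreover have "connected (\<P> ` U)"
      using U(2) hol by (intro connected_continuous_image holomorphic_on_imp_continuous_on)
    ultimately obtain c where c: "\<And>x. x \<in> U \<Longrightarrow> \<P> x = c"
      using connected_finite_iff_sing[of "\<P> ` U"] U(3) by (metis image_eqI image_is_empty singletonD)
    obtain x where x: "x \<in> U" using U(3) by blast
    have "(\<P> has_field_derivative 0) (at x)"
      by (rule has_field_derivative_transform_within_open[OF DERIV_const U(1) x]) (simp add: c)
    then show False using deriv_nz[OF x] DERIV_imp_deriv by blast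
  qed
  then have dim: "cfun.dim V = d + 1"
    unfolding V using \<Phi>_nz by (rule dim_power_span)
  have T_annihilator: "monic_annihilator_on U (d + 1) V T"
    unfolding monic_annihilator_on_def monic_diff_op_on_iff_linear_diff_op_on V power_span_eq
    using T_monic T_0 by auto
  have unique: "operators_eq_on U T L" if L: "monic_annihilator_on U (d + 1) V L" for L
  proof -
    have L_monic: "linear_diff_op_on U (d + 1) (\<lambda>_. 1) L"
      using L by (simp add: monic_annihilator_on_def monic_diff_op_on_iff_linear_diff_op_on)
    show ?thesis
    proof (rule linear_diff_op_on_unique[OF U(1) hol deriv_nz hol_\<Phi> \<Phi>_nz T_monic L_monic])
      fix k x assume k: "k < d + 1" and x: "x \<in> U"
      define r where "r = [:- \<P> x, 1:] ^ k"
      have r: "degree r \<le> d" "poly r (\<P> y) = (\<P> y - \<P> x) ^ k" for y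
        using k by (simp_all add: r_def degree_linear_power)
      let ?F = "\<lambda>y. \<Phi> y * (\<P> y - \<P> x) ^ k"
      \<comment> \<open>Only \<open>?G\<close> lies in \<open>V\<close>, while the uniqueness
        criterion tests \<open>?F\<close>; locality of \<open>L\<close> links the two.\<close>
      let ?G = "\<lambda>y. if y \<in> U then \<Phi> y * poly r (\<P> y) else 0"
      have "?F holomorphic_on U"
        by (intro holomorphic_intros hol hol_\<Phi>)
      then have "L ?F x = L ?G x"
        by (rule linear_diff_op_on_local[OF U(1) L_monic _ _ x]) (simp add: r(2))
      moreover have "?G \<in> V"
        unfolding V power_span_eq using r(1) by blast
      ultimately have "L ?F x = 0"
        using L x by (simp add: monic_annihilator_on_def)
      moreover have "T ?F x = 0"
        by (rule T_0[OF r(1) _ x]) (simp add: r(2))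
      ultimately show "T ?F x = L ?F x" by simp
    qed
  qed
  show ?thesis
    using dim T_annihilator unique unfolding T_def Phi \<Psi>_def by blast
qed

end
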